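(* Let $\mathscr{H}$ be a complex Hilbert space and let $A\in\mathbb{B}(\mathscr{H})$. Then for all real $r\geq 1$, $$w^{2r}(A)\leq \frac14\big\| |A|^{2r}+|A^*|^{2r}\big\|+\frac12\min\Big\{\big\|\Re(|A|^r|A^*|^r)\big\|,\ w^r(A^2)\Big\}.$$
   Context: $\mathbb{B}(\mathscr{H})$ is the $C^*$-algebra of bounded linear operators on $\mathscr{H}$. For $T\in\mathbb{B}(\mathscr{H})$: $\|T\|$ is the operator norm; $|T|=(T^*T)^{1/2}$ is the positive square root of $T^*T$ (so $|T^*|=(TT^* )^{1/2}$), with powers $|T|^s$ taken by the functional calculus; $\Re(T)=\frac12(T+T^* )$; the numerical radius is $w(T)=\sup\{|\langle Tx,x\rangle| : x\in\mathscr{H},\ \|x\|=1\}$, and $w^s(T)$ means $(w(T))^s$. *)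

theory Defs
  imports "HOL-Analysis.Analysis" "HOL-Computational_Algebra.Polynomial"
begin

(* A complex inner product determines the real one as its real part; by the last axiom the norm
   inherited from real_inner is the Hilbert space norm (lemma cinner_self), and positive
   definiteness is inherited as well. The inner product is linear in its first argument. *)
class complex_inner = real_inner +
  fixes scaleC :: "complex \<Rightarrow> 'a \<Rightarrow> 'a" (infixr "*\<^sub>C" 75)
    and cinner :: "'a \<Rightarrow> 'a \<Rightarrow> complex"
  assumes scaleC_add_right: "c *\<^sub>C (x + y) = c *\<^sub>C x + c *\<^sub>C y"
    and scaleC_add_left: "(c + d) *\<^sub>C x = c *\<^sub>C x + d *\<^sub>C x"
    and scaleC_scaleC: "c *\<^sub>C d *\<^sub>C x = (c * d) *\<^sub>C x"
    and scaleC_of_real: "complex_of_real t *\<^sub>C x = t *\<^sub>R x"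
    and cinner_add_left: "cinner (x + y) z = cinner x z + cinner y z"
    and cinner_scaleC_left: "cinner (c *\<^sub>C x) y = c * cinner x y"
    and cinner_commute: "cinner x y = cnj (cinner y x)"
    and inner_eq_Re_cinner: "inner x y = Re (cinner x y)"

class chilbert_space = complex_inner + complete_space

lemma cinner_self: "cinner x x = complex_of_real ((norm x)\<^sup>2)"
proof -
  have "Im (cinner x x) = 0"
    using arg_cong[OF cinner_commute[of x x], of Im] by simp
  then show ?thesis
    by (simp add: complex_eq_iff power2_norm_eq_inner inner_eq_Re_cinner)
qed

instantiation complex :: chilbert_space
begin

definition "c *\<^sub>C (x :: complex) = c * x"
definition "cinner (x :: complex) y = x * cnj y"

instance
  by standard
    (simp_all add: scaleC_complex_def cinner_complex_def inner_complex_def algebra_simps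
      scaleR_conv_of_real)

end

definition bounded_clinear :: "('a::complex_inner \<Rightarrow> 'b::complex_inner) \<Rightarrow> bool" where
  "bounded_clinear T \<longleftrightarrow> bounded_linear T \<and> (\<forall>c x. T (c *\<^sub>C x) = c *\<^sub>C T x)"

definition cadjoint :: "('a::chilbert_space \<Rightarrow> 'a) \<Rightarrow> 'a \<Rightarrow> 'a" where
  "cadjoint T = (THE S. \<forall>x y. cinner (T x) y = cinner x (S y))"

definition op_Re :: "('a::chilbert_space \<Rightarrow> 'a) \<Rightarrow> 'a \<Rightarrow> 'a" where
  "op_Re T = (\<lambda>x. (1/2) *\<^sub>R (T x + cadjoint T x))"

(* The supremum is taken in [0, \<infinity>), which only matters for the zero space, where the set
   of unit vectors is empty. *)
definition numerical_radius :: "('a::chilbert_space \<Rightarrow> 'a) \<Rightarrow> real" where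
  "numerical_radius T = Sup (insert 0 {cmod (cinner (T x) x) | x. norm x = 1})"

definition positive_op :: "('a::chilbert_space \<Rightarrow> 'a) \<Rightarrow> bool" where
  "positive_op T \<longleftrightarrow> bounded_clinear T \<and> (\<forall>x. cinner (T x) x \<in> \<real>\<^sub>\<ge>\<^sub>0)"

definition op_abs :: "('a::chilbert_space \<Rightarrow> 'a) \<Rightarrow> 'a \<Rightarrow> 'a" where
  "op_abs T = (THE S. positive_op S \<and> S \<circ> S = cadjoint T \<circ> T)"

definition op_spectrum :: "('a::chilbert_space \<Rightarrow> 'a) \<Rightarrow> complex set" where
  "op_spectrum T = {z. \<not> (\<exists>S. bounded_clinear S \<and>
     (\<forall>x. S (T x - z *\<^sub>C x) = x) \<and> (\<forall>x. T (S x) - z *\<^sub>C S x = x))}"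

definition op_poly :: "real poly \<Rightarrow> ('a::chilbert_space \<Rightarrow> 'a) \<Rightarrow> 'a \<Rightarrow> 'a" where
  "op_poly p T = (\<lambda>x. \<Sum>i\<le>degree p. coeff p i *\<^sub>R (T ^^ i) x)"

(* Continuous functional calculus of a self-adjoint operator T, whose spectrum is real, for a real
   function f continuous on the spectrum: f(T) is the operator norm limit of p\<^sub>n(T) whenever
   polynomials p\<^sub>n tend to f uniformly on the spectrum. *)
definition op_fun :: "(real \<Rightarrow> real) \<Rightarrow> ('a::chilbert_space \<Rightarrow> 'a) \<Rightarrow> 'a \<Rightarrow> 'a" where
  "op_fun f T = (THE S. bounded_clinear S \<and>
     (\<forall>p :: nat \<Rightarrow> real poly.
        uniform_limit {t. complex_of_real t \<in> op_spectrum T} (\<lambda>n. poly (p n)) f sequentially \<longrightarrow>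
        (\<lambda>n. onorm (\<lambda>x. op_poly (p n) T x - S x)) \<longlonglongrightarrow> 0))"

(* Intended for positive T and s > 0; recall that 0 powr s = 0. *)
definition op_powr :: "('a::chilbert_space \<Rightarrow> 'a) \<Rightarrow> real \<Rightarrow> 'a \<Rightarrow> 'a" where
  "op_powr T s = op_fun (\<lambda>t. t powr s) T"

end

theory Submission
  imports Defs "HOL-Computational_Algebra.Fundamental_Theorem_Algebra"
begin

text \<open>For a unit vector \<open>x\<close> it is enough to bound \<open>\<bar>\<langle>Ax, x\<rangle>\<bar>\<^sup>2\<^sup>r\<close> by each of the two expressions hidden in the
minimum. Both bounds rest on McCarthy's inequality \<open>\<langle>q(T)x, x\<rangle>\<^sup>r \<le> \<langle>q(T)\<^sup>r x, x\<rangle>\<close> for positive \<open>T\<close> and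
\<open>q \<ge> 0\<close> (lemma \<open>McCarthy_inequality\<close>), which is the tangent line inequality for the convex function
\<open>t \<mapsto> t\<^sup>r\<close> inserted into the functional calculus.

For the bound with \<open>\<Re>(PQ)\<close>, where \<open>P = |A|\<^sup>r\<close> and \<open>Q = |A\<^sup>*|\<^sup>r\<close>, the mixed Schwarz inequality
\<open>\<bar>\<langle>Ax, x\<rangle>\<bar>\<^sup>2 \<le> \<langle>|A|x, x\<rangle> \<langle>|A\<^sup>*|x, x\<rangle>\<close> (lemma \<open>mixed_Schwarz\<close>) and McCarthy's inequality give
\<open>\<bar>\<langle>Ax, x\<rangle>\<bar>\<^sup>2\<^sup>r \<le> \<langle>Px, x\<rangle> \<langle>Qx, x\<rangle>\<close>. By the arithmetic-geometric mean inequality and Cauchy-Schwarz this is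
at most \<open>\<parallel>(P + Q)x\<parallel>\<^sup>2 / 4\<close>, and expanding the square gives \<open>\<langle>(P\<^sup>2 + Q\<^sup>2)x, x\<rangle> / 4 + \<langle>\<Re>(PQ)x, x\<rangle> / 2\<close>.

For the bound with \<open>w(A\<^sup>2)\<close>, Buzano's inequality (lemma \<open>Buzano_inequality\<close>) gives
\<open>\<bar>\<langle>Ax, x\<rangle>\<bar>\<^sup>2 \<le> (\<parallel>Ax\<parallel> \<parallel>A\<^sup>*x\<parallel> + \<bar>\<langle>A\<^sup>2x, x\<rangle>\<bar>) / 2\<close>. Raise this to the power \<open>r\<close>, using convexity, and estimate
\<open>\<parallel>Ax\<parallel>\<^sup>r \<parallel>A\<^sup>*x\<parallel>\<^sup>r\<close> by the mean of \<open>\<parallel>Ax\<parallel>\<^sup>2\<^sup>r \<le> \<langle>|A|\<^sup>2\<^sup>r x, x\<rangle>\<close> and its counterpart for \<open>A\<^sup>*\<close>.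

The adjoint, the modulus and the powers are given by unique descriptions, and most of the text
proves that the operators so described exist. The adjoint comes from the Riesz representation theorem. The functional
calculus comes from the estimate \<open>\<parallel>p(T)\<parallel> \<le> sup |p|\<close> over the real spectrum of a self-adjoint \<open>T\<close>
(lemma \<open>norm_op_poly_le_spectrum\<close>), together with the Weierstrass approximation theorem and the
inclusion of the spectrum of a positive operator in a compact interval. Square roots, and with them
the modulus, are the case of the function \<open>sqrt\<close>.\<close>

section \<open>Complex inner products\<close>

lemma cinner_add_right: "cinner x (y + z) = cinner x y + cinner x z"
  by (metis cinner_add_left cinner_commute complex_cnj_add)

lemma cinner_scaleC_right: "cinner x (c *\<^sub>C y) = cnj c * cinner x y"
  by (metis cinner_commute cinner_scaleC_left complex_cnj_mult)

lemma scaleR_scaleC: "t *\<^sub>R x = complex_of_real t *\<^sub>C (x::'a::complex_inner)"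
  by (simp add: scaleC_of_real)

lemma scaleC_one [simp]: "1 *\<^sub>C (x::'a::complex_inner) = x"
  using scaleC_of_real[of 1 x] by simp

lemma scaleC_zero_left [simp]: "0 *\<^sub>C (x::'a::complex_inner) = 0"
  using scaleC_of_real[of 0 x] by simp

lemma scaleC_zero_right [simp]: "c *\<^sub>C (0::'a::complex_inner) = 0"
  using scaleC_add_right[of c 0 0] by simp

lemma scaleC_minus_left: "(- c) *\<^sub>C (x::'a::complex_inner) = - (c *\<^sub>C x)"
  using scaleC_add_left[of "- c" c x] by (simp add: eq_neg_iff_add_eq_0)

lemma scaleC_minus_right: "c *\<^sub>C (- x) = - (c *\<^sub>C (x::'a::complex_inner))"
  using scaleC_add_right[of c "- x" x] by (simp add: eq_neg_iff_add_eq_0)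

lemma scaleC_diff_right: "c *\<^sub>C (x - y) = c *\<^sub>C x - c *\<^sub>C (y::'a::complex_inner)"
  using scaleC_add_right[of c x "- y"] by (simp add: scaleC_minus_right)

lemma cinner_scaleR_left: "cinner (t *\<^sub>R x) y = complex_of_real t * cinner x y"
  by (simp add: scaleR_scaleC cinner_scaleC_left)

lemma cinner_scaleR_right: "cinner x (t *\<^sub>R y) = complex_of_real t * cinner x y"
  by (simp add: scaleR_scaleC cinner_scaleC_right)

lemma cinner_zero_left [simp]: "cinner 0 y = 0"
  using cinner_scaleC_left[of 0 0 y] by simp

lemma cinner_zero_right [simp]: "cinner x 0 = 0"
  using cinner_scaleC_right[of x 0 0] by simp

lemma cinner_minus_left: "cinner (- x) y = - cinner x y"
  using cinner_scaleC_left[of "- 1" x y] by (simp add: scaleC_minus_left)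

lemma cinner_minus_right: "cinner x (- y) = - cinner x y"
  using cinner_scaleC_right[of x "- 1" y] by (simp add: scaleC_minus_left)

lemma cinner_diff_left: "cinner (x - y) z = cinner x z - cinner y z"
  using cinner_add_left[of x "- y" z] by (simp add: cinner_minus_left)

lemma cinner_diff_right: "cinner x (y - z) = cinner x y - cinner x z"
  using cinner_add_right[of x y "- z"] by (simp add: cinner_minus_right)

lemmas cinner_linear = cinner_add_left cinner_add_right cinner_diff_left cinner_diff_right
  cinner_scaleC_left cinner_scaleC_right cinner_scaleR_left cinner_scaleR_right
  cinner_minus_left cinner_minus_right

lemma norm_scaleC: "norm (c *\<^sub>C x) = cmod c * norm (x::'a::complex_inner)"
proof -
  have "complex_of_real ((norm (c *\<^sub>C x))\<^sup>2) = c * cnj c * complex_of_real ((norm x)\<^sup>2)"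
    by (simp only: cinner_self[symmetric] cinner_scaleC_left cinner_scaleC_right ac_simps)
  also have "\<dots> = complex_of_real ((cmod c * norm x)\<^sup>2)"
    by (simp only: complex_norm_square[symmetric] of_real_mult of_real_power power_mult_distrib)
  finally have "(norm (c *\<^sub>C x))\<^sup>2 = (cmod c * norm x)\<^sup>2"
    by (simp only: of_real_eq_iff)
  then show ?thesis
    by (simp add: power2_eq_iff_nonneg)
qed

lemma cinner_eqI: "x = y" if "\<And>z. cinner z x = cinner z y"
  using that[of "x - y"] cinner_self[of "x - y"] by (simp add: cinner_diff_right)

lemma complex_rotate_to_norm:
  obtains c :: complex where "cmod c = 1" "c * z = of_real (cmod z)"
proof (cases "z = 0")
  case True
  then show ?thesis using that[of 1] by simp
next
  case False
  show ?thesis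
  proof (rule that[of "of_real (cmod z) / z"])
    show "cmod (of_real (cmod z) / z) = 1" "of_real (cmod z) / z * z = of_real (cmod z)"
      using False by (simp_all add: norm_divide)
  qed
qed

lemma cinner_Cauchy_Schwarz: "cmod (cinner x y) \<le> norm x * norm y"
proof -
  obtain c where c: "cmod c = 1" "c * cinner x y = of_real (cmod (cinner x y))"
    by (rule complex_rotate_to_norm)
  have "cmod (cinner x y) = inner (c *\<^sub>C x) y"
    by (simp add: inner_eq_Re_cinner cinner_scaleC_left c)
  also have "\<dots> \<le> norm (c *\<^sub>C x) * norm y"
    by (rule norm_cauchy_schwarz)
  finally show ?thesis
    by (simp add: norm_scaleC c)
qed

text \<open>The vector \<open>2\<langle>x, e\<rangle>e - x\<close> is the reflection of \<open>x\<close> in the line spanned by \<open>e\<close>, so it is as long as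
\<open>x\<close>. Cauchy-Schwarz for this vector and \<open>y\<close> is the claim.\<close>

lemma Buzano_inequality:
  assumes "norm e = 1"
  shows "cmod (cinner x e * cinner e y) \<le> (norm x * norm y + cmod (cinner x y)) / 2"
proof -
  define u where "u = (2 * cinner x e) *\<^sub>C e - x"
  have ee: "cinner e e = 1"
    using assms by (simp add: cinner_self)
  have "cinner u u = cinner x x"
    by (simp add: u_def cinner_linear ee algebra_simps cinner_commute[of e x])
  then have "complex_of_real ((norm u)\<^sup>2) = complex_of_real ((norm x)\<^sup>2)"
    by (simp only: cinner_self)
  then have norm_u: "norm u = norm x"
    by (metis norm_ge_zero of_real_eq_iff power2_eq_iff_nonneg)
  have "2 * (cinner x e * cinner e y) = cinner u y + cinner x y"
    by (simp add: u_def cinner_linear)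
  then have "2 * cmod (cinner x e * cinner e y) \<le> cmod (cinner u y) + cmod (cinner x y)"
    by (metis norm_mult norm_numeral norm_triangle_ineq)
  also have "cmod (cinner u y) \<le> norm x * norm y"
    using cinner_Cauchy_Schwarz[of u y] norm_u by simp
  finally show ?thesis by simp
qed

section \<open>Riesz representation and adjoints\<close>

text \<open>The representing vector minimises \<open>J x = \<parallel>x\<parallel>\<^sup>2 - 2 \<phi> x\<close>. By the parallelogram identity every minimising
sequence is a Cauchy sequence, and the first variation of \<open>J\<close> vanishes at the limit.\<close>

lemma Riesz_representation:
  fixes \<phi> :: "'a::{real_inner,complete_space} \<Rightarrow> real"
  assumes "bounded_linear \<phi>"
  obtains z where "\<And>x. \<phi> x = inner x z"
proof -
  interpret bounded_linear \<phi> by fact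
  obtain K where K: "\<And>x. norm (\<phi> x) \<le> norm x * K"
    using bounded by blast
  define J where "J x = inner x x - 2 * \<phi> x" for x
  have J_ge: "- K\<^sup>2 \<le> J x" for x
  proof -
    have "0 \<le> (norm x - K)\<^sup>2" by simp
    with K[of x] show ?thesis
      by (simp add: J_def power2_diff abs_le_iff flip: power2_norm_eq_inner)
  qed
  define m where "m = Inf (range J)"
  have bdd: "bdd_below (range J)"
    by (rule bdd_belowI2) (rule J_ge)
  have m_le: "m \<le> J x" for x
    unfolding m_def by (intro cInf_lower bdd) simp
  have "\<exists>x. J x < m + 1 / real (Suc n)" for n
    using cInf_lessD[of "range J" "m + 1 / real (Suc n)"] by (auto simp: m_def)
  then obtain X where X: "\<And>n. J (X n) < m + 1 / real (Suc n)"
    by metis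
  have parallelogram: "(norm (x - y))\<^sup>2 = 2 * J x + 2 * J y - 4 * J ((1/2) *\<^sub>R (x + y))" for x y
    unfolding J_def power2_norm_eq_inner
    by (simp add: inner_add inner_diff add scale inner_commute[of y x] algebra_simps)
  have X_dist: "(dist (X i) (X j))\<^sup>2 < 4 / real (Suc n)" if "n \<le> i" "n \<le> j" for i j n
  proof -
    have "1 / real (Suc i) \<le> 1 / real (Suc n)" "1 / real (Suc j) \<le> 1 / real (Suc n)"
      using that by (simp_all add: frac_le)
    with X[of i] X[of j] m_le[of "(1/2) *\<^sub>R (X i + X j)"] show ?thesis
      unfolding dist_norm parallelogram by simp
  qed
  have "Cauchy X"
  proof (rule metric_CauchyI)
    fix e :: real assume "0 < e"
    obtain n where n: "4 / real (Suc n) < e\<^sup>2"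
      using reals_Archimedean[of "e\<^sup>2 / 4"] \<open>0 < e\<close> by (auto simp: divide_simps mult.commute)
    have "dist (X i) (X j) < e" if "n \<le> i" "n \<le> j" for i j
      using X_dist[OF that] n \<open>0 < e\<close> by (intro power2_less_imp_less[of _ e]) auto
    then show "\<exists>M. \<forall>i\<ge>M. \<forall>j\<ge>M. dist (X i) (X j) < e" by blast
  qed
  then obtain z where z: "X \<longlonglongrightarrow> z"
    using Cauchy_convergent convergent_def by blast
  have "(\<lambda>n. J (X n)) \<longlonglongrightarrow> J z"
    unfolding J_def by (intro tendsto_intros z tendsto)
  moreover have "(\<lambda>n. m + 1 / real (Suc n)) \<longlonglongrightarrow> m + 0"
    by (intro tendsto_intros LIMSEQ_Suc[OF lim_1_over_n])
  ultimately have "J z \<le> m + 0"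
    by (rule LIMSEQ_le) (use X less_imp_le in blast)
  then have J_min: "J z \<le> J x" for x
    using m_le[of x] by simp
  have "\<phi> v = inner v z" for v
  proof -
    define d where "d = inner v z - \<phi> v"
    define q where "q = inner v v"
    \<comment> \<open>The best step in the direction \<open>v\<close> would be \<open>- d / q\<close>; the summand 1 covers \<open>q = 0\<close>.\<close>
    define t where "t = - d / (q + 1)"
    have q: "0 \<le> q" by (simp add: q_def)
    have "0 \<le> J (z + t *\<^sub>R v) - J z"
      using J_min by simp
    also have "\<dots> = 2 * t * d + t\<^sup>2 * q"
      by (simp add: J_def d_def q_def inner_add add scale inner_commute[of z v]
          power2_eq_square algebra_simps)
    also have "d = - t * (q + 1)"
      using q by (simp add: t_def)
    also have "2 * t * (- t * (q + 1)) + t\<^sup>2 * q = - (t\<^sup>2 * (q + 2))"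
      by (simp add: power2_eq_square algebra_simps)
    finally have "t\<^sup>2 * (q + 2) \<le> 0" by simp
    then have "t = 0"
      using q by (simp add: mult_le_0_iff)
    then have "d = 0"
      using q by (simp add: t_def)
    then show ?thesis by (simp add: d_def)
  qed
  then show ?thesis by (rule that)
qed

lemma bounded_clinear_bounded_linear: "bounded_clinear T \<Longrightarrow> bounded_linear T"
  by (simp add: bounded_clinear_def)

lemma bounded_clinear_simps:
  assumes "bounded_clinear T"
  shows "T (x + y) = T x + T y" "T (x - y) = T x - T y" "T (- x) = - T x" "T 0 = 0"
    "T (r *\<^sub>R x) = r *\<^sub>R T x" "T (c *\<^sub>C x) = c *\<^sub>C T x" "T (sum g I) = (\<Sum>i\<in>I. T (g i))"
  using assms bounded_clinear_bounded_linear[OF assms, THEN bounded_linear.linear]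
  by (simp_all add: bounded_clinear_def linear_add linear_diff linear_neg linear_0
      linear_scale linear_sum)

lemma bounded_clinear_norm_le:
  assumes "bounded_clinear T" shows "norm (T x) \<le> onorm T * norm x"
  using onorm[OF bounded_clinear_bounded_linear[OF assms]] .

lemma bounded_clinearI:
  fixes T :: "'a::complex_inner \<Rightarrow> 'b::complex_inner"
  assumes add: "\<And>x y. T (x + y) = T x + T y" and scale: "\<And>c x. T (c *\<^sub>C x) = c *\<^sub>C T x"
    and bound: "\<And>x. norm (T x) \<le> K * norm x"
  shows "bounded_clinear T"
  unfolding bounded_clinear_def
proof (intro conjI allI scale)
  show "bounded_linear T"
    by (rule bounded_linear_intro[where K = K])
      (use bound in \<open>auto simp: add scale scaleR_scaleC mult.commute\<close>)
qed

lemma bounded_clinear_compose: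
  assumes "bounded_clinear S" "bounded_clinear T"
  shows "bounded_clinear (\<lambda>x. S (T x))"
  using assms unfolding bounded_clinear_def by (auto intro: bounded_linear_compose)

lemma bounded_clinear_add:
  assumes "bounded_clinear S" "bounded_clinear T"
  shows "bounded_clinear (\<lambda>x. S x + T x)"
  using assms unfolding bounded_clinear_def
  by (auto intro: bounded_linear_add simp: scaleC_add_right)

lemma bounded_clinear_diff:
  assumes "bounded_clinear S" "bounded_clinear T"
  shows "bounded_clinear (\<lambda>x. S x - T x)"
  using assms unfolding bounded_clinear_def
  by (auto intro: bounded_linear_sub simp: scaleC_diff_right)

lemma bounded_clinear_zero: "bounded_clinear (\<lambda>x. 0)"
  by (simp add: bounded_clinear_def)

lemma bounded_clinear_scaleC: "bounded_clinear ((*\<^sub>C) c)"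
  by (rule bounded_clinearI[where K = "cmod c"])
    (simp_all add: scaleC_add_right scaleC_scaleC norm_scaleC mult.commute)

lemma bounded_clinear_scaleR: "bounded_clinear ((*\<^sub>R) r)"
  by (rule bounded_clinearI[where K = "\<bar>r\<bar>"])
    (simp_all add: scaleR_scaleC scaleC_add_right scaleC_scaleC norm_scaleC mult.commute)

lemma cadjoint_exists:
  fixes A :: "'a::chilbert_space \<Rightarrow> 'a"
  assumes A: "bounded_clinear A"
  shows "\<exists>S. \<forall>x y. cinner (A x) y = cinner x (S y)"
proof -
  have "\<exists>z. \<forall>x. cinner (A x) y = cinner x z" for y
  proof -
    have "bounded_linear (\<lambda>x. inner (A x) y)"
      by (rule bounded_linear_compose[OF bounded_linear_inner_left
            bounded_clinear_bounded_linear[OF A]])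
    from Riesz_representation[OF this] obtain z where z: "\<And>x. inner (A x) y = inner x z"
      by blast
    \<comment> \<open>Applying the real identity to the vector multiplied by \<open>\<i>\<close> compares imaginary parts.\<close>
    have "cinner (A x) y = cinner x z" for x
      using z[of x] z[of "\<i> *\<^sub>C x"]
      by (simp add: complex_eq_iff inner_eq_Re_cinner bounded_clinear_simps[OF A]
          cinner_scaleC_left)
    then show ?thesis by blast
  qed
  then show ?thesis by metis
qed

lemma cadjoint_eqI:
  assumes "\<And>x y. cinner (A x) y = cinner x (S y)"
  shows "cadjoint A = S"
  unfolding cadjoint_def
proof (rule the_equality)
  show "\<forall>x y. cinner (A x) y = cinner x (S y)"
    using assms by blast
next
  fix R assume "\<forall>x y. cinner (A x) y = cinner x (R y)"
  then have "cinner x (R y) = cinner x (S y)" for x y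
    using assms by metis
  then show "R = S"
    by (rule ext[OF cinner_eqI])
qed

lemma cinner_cadjoint:
  assumes "bounded_clinear A"
  shows "cinner (A x) y = cinner x (cadjoint A y)"
proof -
  obtain S where S: "\<And>x y. cinner (A x) y = cinner x (S y)"
    using cadjoint_exists[OF assms] by blast
  then have "cadjoint A = S" by (rule cadjoint_eqI)
  with S show ?thesis by simp
qed

lemma cinner_cadjoint_left:
  assumes "bounded_clinear A"
  shows "cinner (cadjoint A x) y = cinner x (A y)"
  using cinner_cadjoint[OF assms, of y x, THEN arg_cong[where f = cnj]]
  by (simp add: cinner_commute[symmetric])

lemma bounded_clinear_cadjoint:
  assumes A: "bounded_clinear A"
  shows "bounded_clinear (cadjoint A)"
proof (rule bounded_clinearI[where K = "onorm A"])
  show "cadjoint A (x + y) = cadjoint A x + cadjoint A y" for x y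
    by (rule cinner_eqI) (simp add: cinner_add_right flip: cinner_cadjoint[OF A])
  show "cadjoint A (c *\<^sub>C x) = c *\<^sub>C cadjoint A x" for c x
    by (rule cinner_eqI) (simp add: cinner_scaleC_right flip: cinner_cadjoint[OF A])
  show "norm (cadjoint A x) \<le> onorm A * norm x" for x
  proof (cases "cadjoint A x = 0")
    case False
    have "(norm (cadjoint A x))\<^sup>2 = cmod (cinner (cadjoint A x) (cadjoint A x))"
      by (simp add: cinner_self norm_power)
    also have "\<dots> = cmod (cinner (A (cadjoint A x)) x)"
      by (simp add: cinner_cadjoint[OF A])
    also have "\<dots> \<le> norm (A (cadjoint A x)) * norm x"
      by (rule cinner_Cauchy_Schwarz)
    also have "\<dots> \<le> onorm A * norm (cadjoint A x) * norm x"
      by (intro mult_right_mono bounded_clinear_norm_le[OF A]) simp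
    finally show ?thesis
      using False by (simp add: power2_eq_square)
  qed (simp add: onorm_pos_le[OF bounded_clinear_bounded_linear[OF A]])
qed

lemma cadjoint_cadjoint:
  assumes "bounded_clinear A"
  shows "cadjoint (cadjoint A) = A"
  by (rule cadjoint_eqI) (rule cinner_cadjoint_left[OF assms])

text \<open>The Lax-Milgram theorem: \<open>T x = y\<close> holds exactly for the fixed points of
\<open>x \<mapsto> x - \<rho>(T x - y)\<close>, which is a contraction for small \<open>\<rho> > 0\<close>. This is the source of all
inverses below, both for locating spectra and for solving equations.\<close>

lemma coercive_inverse:
  fixes T :: "'a::chilbert_space \<Rightarrow> 'a"
  assumes T: "bounded_clinear T" and c: "0 < c"
    and coercive: "\<And>x. c * (norm x)\<^sup>2 \<le> inner (T x) x"
  obtains S where "bounded_clinear S" "\<And>x. S (T x) = x" "\<And>x. T (S x) = x"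
proof -
  \<comment> \<open>A bound of at least \<open>c\<close> stays positive on the zero space and makes \<open>1 - (c / K)\<^sup>2\<close> nonnegative.\<close>
  define K where "K = max c (onorm T)"
  have K: "norm (T x) \<le> K * norm x" for x
    using bounded_clinear_norm_le[OF T, of x]
    by (rule order_trans) (simp add: K_def mult_right_mono)
  have K_ge: "c \<le> K" and K_pos: "0 < K"
    using c by (auto simp: K_def)
  \<comment> \<open>This \<open>\<rho>\<close> minimises the squared contraction factor \<open>1 - 2 \<rho> c + \<rho>\<^sup>2 K\<^sup>2\<close>.\<close>
  define \<rho> where "\<rho> = c / K\<^sup>2"
  define \<kappa> where "\<kappa> = sqrt (1 - (c / K)\<^sup>2)"
  have cK: "0 < c / K" "c / K \<le> 1"
    using c K_pos K_ge by (auto simp: divide_le_eq)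
  have \<kappa>: "0 \<le> \<kappa>" "\<kappa> < 1" "\<kappa>\<^sup>2 = 1 - (c / K)\<^sup>2"
    using cK by (auto simp: \<kappa>_def power_le_one)
  have contraction: "norm (x - \<rho> *\<^sub>R T x) \<le> \<kappa> * norm x" for x
  proof (rule power2_le_imp_le)
    have "(norm (x - \<rho> *\<^sub>R T x))\<^sup>2 = (norm x)\<^sup>2 - 2 * \<rho> * inner (T x) x + \<rho>\<^sup>2 * (norm (T x))\<^sup>2"
      unfolding power2_norm_eq_inner
      by (simp add: inner_diff inner_commute[of x "T x"] power2_eq_square algebra_simps)
    also have "\<dots> \<le> (norm x)\<^sup>2 - 2 * \<rho> * (c * (norm x)\<^sup>2) + \<rho>\<^sup>2 * (K * norm x)\<^sup>2"
      using c K_pos K by (intro add_mono diff_mono mult_left_mono coercive power_mono)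
        (auto simp: \<rho>_def)
    also have "\<dots> = (1 - 2 * (\<rho> * c) + \<rho>\<^sup>2 * K\<^sup>2) * (norm x)\<^sup>2"
      by (simp add: power_mult_distrib algebra_simps)
    also have "1 - 2 * (\<rho> * c) + \<rho>\<^sup>2 * K\<^sup>2 = \<kappa>\<^sup>2"
    proof -
      have "\<rho> * c = (c / K)\<^sup>2" "\<rho> * K = c / K"
        using K_pos by (simp_all add: \<rho>_def power2_eq_square)
      then show ?thesis
        by (simp add: \<kappa> flip: power_mult_distrib)
    qed
    also have "\<dots> * (norm x)\<^sup>2 = (\<kappa> * norm x)\<^sup>2"
      by (simp add: power_mult_distrib)
    finally show "(norm (x - \<rho> *\<^sub>R T x))\<^sup>2 \<le> (\<kappa> * norm x)\<^sup>2" .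
  qed (use \<kappa> in simp)
  have "\<exists>!x. T x = y" for y
  proof -
    let ?F = "\<lambda>x. x - \<rho> *\<^sub>R (T x - y)"
    have "?F x - ?F x' = (x - x') - \<rho> *\<^sub>R T (x - x')" for x x'
      by (simp add: bounded_clinear_simps[OF T] algebra_simps)
    then have "\<forall>x x'. dist (?F x) (?F x') \<le> \<kappa> * dist x x'"
      unfolding dist_norm using contraction by metis
    then have "\<exists>!x. ?F x = x"
      by (rule banach_fix_type[OF \<kappa>(1,2)])
    moreover have "?F x = x \<longleftrightarrow> T x = y" for x
      using c K_pos by (simp add: \<rho>_def)
    ultimately show ?thesis by simp
  qed
  then obtain S where TS: "\<And>y. T (S y) = y" and uniq: "\<And>x y. T x = y \<Longrightarrow> x = S y"
    by metis
  have "bounded_clinear S"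
  proof (rule bounded_clinearI[where K = "1 / c"])
    show "S (x + y) = S x + S y" for x y
      by (rule uniq[symmetric]) (simp add: bounded_clinear_simps[OF T] TS)
    show "S (a *\<^sub>C x) = a *\<^sub>C S x" for a x
      by (rule uniq[symmetric]) (simp add: bounded_clinear_simps[OF T] TS)
    show "norm (S x) \<le> 1 / c * norm x" for x
    proof (cases "S x = 0")
      case False
      have "c * (norm (S x))\<^sup>2 \<le> inner x (S x)"
        using coercive[of "S x"] by (simp add: TS)
      also have "\<dots> \<le> norm x * norm (S x)"
        by (rule norm_cauchy_schwarz)
      finally show ?thesis
        using False c by (simp add: power2_eq_square field_simps)
    qed (use c in simp)
  qed
  moreover have "S (T x) = x" for x
    using uniq[OF refl, of x] by simp
  ultimately show ?thesis
    using TS by (rule that)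
qed

section \<open>Polynomials in an operator\<close>

definition hermitian_op :: "('a::chilbert_space \<Rightarrow> 'a) \<Rightarrow> bool" where
  "hermitian_op T \<longleftrightarrow> bounded_clinear T \<and> (\<forall>x y. cinner (T x) y = cinner x (T y))"

text \<open>Real polynomials only split into linear factors over the complex numbers, so the spectral argument
passes through complex coefficients.\<close>

definition complex_op_poly :: "complex poly \<Rightarrow> ('a::chilbert_space \<Rightarrow> 'a) \<Rightarrow> 'a \<Rightarrow> 'a" where
  "complex_op_poly q T = (\<lambda>x. \<Sum>i\<le>degree q. coeff q i *\<^sub>C (T ^^ i) x)"

definition real_spectrum :: "('a::chilbert_space \<Rightarrow> 'a) \<Rightarrow> real set" where
  "real_spectrum T = {t. complex_of_real t \<in> op_spectrum T}"

lemma complex_op_poly_0 [simp]: "complex_op_poly 0 T x = 0"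
  by (simp add: complex_op_poly_def)

lemma complex_op_poly_pCons:
  assumes "bounded_clinear T"
  shows "complex_op_poly (pCons a q) T x = a *\<^sub>C x + T (complex_op_poly q T x)"
proof (cases "q = 0")
  case True
  then show ?thesis by (simp add: complex_op_poly_def bounded_clinear_simps[OF assms])
next
  case False
  then show ?thesis
    by (simp add: complex_op_poly_def sum.atMost_Suc_shift bounded_clinear_simps[OF assms]
        del: sum.atMost_Suc)
qed

lemma complex_op_poly_add:
  assumes "bounded_clinear T"
  shows "complex_op_poly (p + q) T x = complex_op_poly p T x + complex_op_poly q T x"
  by (induction p q rule: poly_induct2)
    (simp_all add: complex_op_poly_pCons[OF assms] bounded_clinear_simps[OF assms]
      scaleC_add_left)

lemma complex_op_poly_smult:
  assumes "bounded_clinear T"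
  shows "complex_op_poly (smult a q) T x = a *\<^sub>C complex_op_poly q T x"
  by (induction q)
    (simp_all add: complex_op_poly_pCons[OF assms] bounded_clinear_simps[OF assms]
      scaleC_add_right scaleC_scaleC)

lemma complex_op_poly_mult:
  assumes "bounded_clinear T"
  shows "complex_op_poly (p * q) T x = complex_op_poly p T (complex_op_poly q T x)"
  by (induction p)
    (simp_all add: complex_op_poly_pCons[OF assms] complex_op_poly_add[OF assms]
      complex_op_poly_smult[OF assms])

lemma op_poly_eq_complex_op_poly:
  "op_poly p T = complex_op_poly (map_poly complex_of_real p) T"
  by (simp add: op_poly_def complex_op_poly_def degree_map_poly coeff_map_poly scaleC_of_real)

lemma poly_map_poly_of_real:
  "poly (map_poly complex_of_real p) (complex_of_real t) = complex_of_real (poly p t)"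
  by (induction p) (simp_all add: map_poly_pCons)

lemma map_poly_of_real_add:
  "map_poly complex_of_real (p + q) = map_poly complex_of_real p + map_poly complex_of_real q"
  by (rule poly_eqI) (simp add: coeff_map_poly)

lemma map_poly_of_real_mult:
  "map_poly complex_of_real (p * q) = map_poly complex_of_real p * map_poly complex_of_real q"
  by (rule poly_eqI) (simp add: coeff_map_poly coeff_mult)

lemma op_poly_0 [simp]: "op_poly 0 T x = 0"
  by (simp add: op_poly_def)

lemma op_poly_pCons:
  assumes "bounded_clinear T"
  shows "op_poly (pCons a p) T x = a *\<^sub>R x + T (op_poly p T x)"
  by (simp add: op_poly_eq_complex_op_poly map_poly_pCons complex_op_poly_pCons[OF assms]
      scaleC_of_real)

lemma op_poly_add:
  assumes "bounded_clinear T"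
  shows "op_poly (p + q) T x = op_poly p T x + op_poly q T x"
  by (simp add: op_poly_eq_complex_op_poly map_poly_of_real_add complex_op_poly_add[OF assms])

lemma op_poly_mult:
  assumes "bounded_clinear T"
  shows "op_poly (p * q) T x = op_poly p T (op_poly q T x)"
  by (simp add: op_poly_eq_complex_op_poly map_poly_of_real_mult complex_op_poly_mult[OF assms])

lemma op_poly_smult:
  assumes "bounded_clinear T"
  shows "op_poly (smult c p) T x = c *\<^sub>R op_poly p T x"
  using op_poly_mult[OF assms, of "[:c:]" p x]
  by (simp add: op_poly_pCons[OF assms] bounded_clinear_simps[OF assms])


lemma op_poly_diff:
  assumes "bounded_clinear T"
  shows "op_poly (p - q) T x = op_poly p T x - op_poly q T x"
  using op_poly_add[OF assms, of "p - q" q x] by simp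

lemma op_poly_pcompose:
  assumes T: "bounded_clinear T" and q: "bounded_clinear (op_poly q T)"
  shows "op_poly (pcompose p q) T x = op_poly p (op_poly q T) x"
  by (induction p)
    (simp_all add: pcompose_pCons op_poly_pCons[OF T] op_poly_pCons[OF q] op_poly_add[OF T]
      op_poly_mult[OF T] bounded_clinear_simps[OF T])

lemma bounded_clinear_op_poly:
  assumes "bounded_clinear T"
  shows "bounded_clinear (op_poly p T)"
proof (induction p)
  case 0
  then show ?case by (simp add: bounded_clinear_zero op_poly_0[abs_def])
next
  case (pCons a p)
  have "bounded_clinear (\<lambda>x. a *\<^sub>R x + T (op_poly p T x))"
    by (intro bounded_clinear_add bounded_clinear_scaleR bounded_clinear_compose[OF assms pCons(2)])
  then show ?case by (simp add: op_poly_pCons[OF assms, abs_def])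
qed

text \<open>Applied with \<open>S = T = A\<close>, this says that \<open>T\<close> commutes with its polynomials; with \<open>T = A\<^sup>*A\<close> and
\<open>S = AA\<^sup>*\<close>, it lets \<open>A\<close> pass from functions of \<open>A\<^sup>*A\<close> to functions of \<open>AA\<^sup>*\<close>.\<close>

lemma op_poly_intertwine:
  assumes S: "bounded_clinear S" and T: "bounded_clinear T" and A: "bounded_clinear A"
    and AT: "\<And>x. A (T x) = S (A x)"
  shows "A (op_poly p T x) = op_poly p S (A x)"
  by (induction p)
    (simp_all add: op_poly_pCons[OF S] op_poly_pCons[OF T] bounded_clinear_simps[OF A] AT)

lemma hermitian_op_bounded_clinear: "hermitian_op T \<Longrightarrow> bounded_clinear T"
  by (simp add: hermitian_op_def)

lemma hermitian_opD: "hermitian_op T \<Longrightarrow> cinner (T x) y = cinner x (T y)"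
  by (simp add: hermitian_op_def)

lemma hermitian_op_inner: "hermitian_op T \<Longrightarrow> inner (T x) y = inner x (T y)"
  by (simp add: inner_eq_Re_cinner hermitian_opD)

lemma hermitian_op_poly:
  assumes T: "hermitian_op T"
  shows "hermitian_op (op_poly p T)"
proof -
  note bT = hermitian_op_bounded_clinear[OF T]
  have "cinner (op_poly p T x) y = cinner x (op_poly p T y)" for x y
    by (induction p arbitrary: x y)
      (simp_all add: op_poly_pCons[OF bT] cinner_linear hermitian_opD[OF T]
        op_poly_intertwine[OF bT bT bT refl])
  then show ?thesis
    using bounded_clinear_op_poly[OF bT] by (simp add: hermitian_op_def)
qed

section \<open>The norm of a polynomial in a self-adjoint operator\<close>

text \<open>Being bounded below is what remains of invertibility in the spectral mapping argument: it holds for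
\<open>T - z\<close> off the spectrum, passes to products, and is refuted by approximate eigenvectors. So no
inverse ever has to be constructed there.\<close>

definition bounded_below :: "('a::chilbert_space \<Rightarrow> 'a) \<Rightarrow> bool" where
  "bounded_below T \<longleftrightarrow> (\<exists>c>0. \<forall>x. c * norm x \<le> norm (T x))"

lemma bounded_below_compose:
  assumes "bounded_below S" "bounded_below T"
  shows "bounded_below (\<lambda>x. S (T x))"
proof -
  obtain c d where c: "0 < c" "\<And>x. c * norm x \<le> norm (S x)"
    and d: "0 < d" "\<And>x. d * norm x \<le> norm (T x)"
    using assms by (auto simp: bounded_below_def)
  have "(c * d) * norm x \<le> norm (S (T x))" for x
  proof -
    have "c * (d * norm x) \<le> c * norm (T x)"
      using c(1) d(2) by (intro mult_left_mono) auto
    with c(2)[of "T x"] show ?thesis by (simp add: mult.assoc)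
  qed
  moreover have "0 < c * d" using c d by simp
  ultimately show ?thesis unfolding bounded_below_def by blast
qed

text \<open>One half of the spectral mapping theorem: by the fundamental theorem of algebra, \<open>q(T)\<close> is a nonzero
multiple of a product of operators \<open>T - z\<close> with \<open>q(z) = 0\<close>.\<close>

lemma complex_op_poly_bounded_below:
  assumes T: "bounded_clinear T"
  shows "q \<noteq> 0 \<Longrightarrow> (\<And>z. poly q z = 0 \<Longrightarrow> bounded_below (\<lambda>x. T x - z *\<^sub>C x)) \<Longrightarrow>
    bounded_below (complex_op_poly q T)"
proof (induction "degree q" arbitrary: q rule: less_induct)
  case less
  show ?case
  proof (cases "degree q = 0")
    case True
    then obtain a where q: "q = [:a:]" by (rule degree_eq_zeroE)
    have "complex_op_poly q T x = a *\<^sub>C x" for x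
      by (simp add: q complex_op_poly_pCons[OF T] bounded_clinear_simps[OF T])
    then have "\<forall>x. cmod a * norm x \<le> norm (complex_op_poly q T x)"
      by (simp add: norm_scaleC)
    then show ?thesis
      using less.prems(1) q unfolding bounded_below_def by (intro exI[of _ "cmod a"]) simp
  next
    case False
    then obtain z where z: "poly q z = 0"
      using alg_closed_imp_poly_has_root[of q] by auto
    then obtain q' where q': "q = [:- z, 1:] * q'"
      by (auto simp: poly_eq_0_iff_dvd dvd_def)
    have "q' \<noteq> 0" using q' less.prems(1) by auto
    then have "degree q = Suc (degree q')"
      unfolding q' by (subst degree_mult_eq) auto
    then have "bounded_below (complex_op_poly q' T)"
      using less.prems(2) \<open>q' \<noteq> 0\<close> by (intro less.hyps) (auto simp: q')
    with less.prems(2)[OF z]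
    have "bounded_below (\<lambda>x. T (complex_op_poly q' T x) - z *\<^sub>C complex_op_poly q' T x)"
      by (rule bounded_below_compose)
    moreover have "complex_op_poly q T x = T (complex_op_poly q' T x) - z *\<^sub>C complex_op_poly q' T x"
      for x
      unfolding q' complex_op_poly_mult[OF T]
      by (simp add: complex_op_poly_pCons[OF T] bounded_clinear_simps[OF T] scaleC_minus_left)
    ultimately show ?thesis by (simp add: bounded_below_def)
  qed
qed

text \<open>\<open>\<langle>Tx, x\<rangle>\<close> is real, so the imaginary part of \<open>\<langle>(T - z)x, x\<rangle>\<close> is \<open>- Im z \<parallel>x\<parallel>\<^sup>2\<close>.\<close>

lemma hermitian_minus_nonreal_bounded_below:
  assumes T: "hermitian_op T" and z: "Im z \<noteq> 0"
  shows "bounded_below (\<lambda>x. T x - z *\<^sub>C x)"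
proof -
  have "\<bar>Im z\<bar> * norm x \<le> norm (T x - z *\<^sub>C x)" for x
  proof (cases "x = 0")
    case False
    have "Im (cinner (T x) x) = 0"
      using cinner_commute[of x "T x", THEN arg_cong[where f = Im]] by (simp add: hermitian_opD[OF T])
    then have "\<bar>Im z\<bar> * (norm x)\<^sup>2 = \<bar>Im (cinner (T x - z *\<^sub>C x) x)\<bar>"
      by (simp add: cinner_linear cinner_self abs_mult flip: of_real_power)
    also have "\<dots> \<le> norm (T x - z *\<^sub>C x) * norm x"
      using abs_Im_le_cmod cinner_Cauchy_Schwarz order_trans by blast
    finally show ?thesis
      using False by (simp add: power2_eq_square)
  qed simp
  then show ?thesis
    using z unfolding bounded_below_def by (intro exI[of _ "\<bar>Im z\<bar>"]) simp
qed

lemma bounded_below_if_not_in_spectrum: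
  assumes "z \<notin> op_spectrum T"
  shows "bounded_below (\<lambda>x. T x - z *\<^sub>C x)"
proof -
  obtain S where S: "bounded_clinear S" "\<And>x. S (T x - z *\<^sub>C x) = x"
    using assms by (auto simp: op_spectrum_def)
  \<comment> \<open>The summand 1 keeps the constant positive on the zero space, where \<open>onorm S = 0\<close>.\<close>
  have S_pos: "0 < onorm S + 1"
    using onorm_pos_le[OF bounded_clinear_bounded_linear[OF S(1)]] by simp
  have "1 / (onorm S + 1) * norm x \<le> norm (T x - z *\<^sub>C x)" for x
  proof -
    have "norm x \<le> onorm S * norm (T x - z *\<^sub>C x)"
      using bounded_clinear_norm_le[OF S(1), of "T x - z *\<^sub>C x"] by (simp add: S(2))
    also have "\<dots> \<le> (onorm S + 1) * norm (T x - z *\<^sub>C x)"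
      by (intro mult_right_mono) auto
    finally show ?thesis
      using S_pos by (simp add: field_simps)
  qed
  then show ?thesis
    using S_pos unfolding bounded_below_def by (intro exI[of _ "1 / (onorm S + 1)"]) simp
qed

lemma hermitian_op_poly_bounded_below:
  assumes T: "hermitian_op T" and "p \<noteq> 0"
    and p: "\<And>t. t \<in> real_spectrum T \<Longrightarrow> poly p t \<noteq> 0"
  shows "bounded_below (op_poly p T)"
  unfolding op_poly_eq_complex_op_poly
proof (rule complex_op_poly_bounded_below)
  show "bounded_clinear T" by (rule hermitian_op_bounded_clinear[OF T])
  show "map_poly complex_of_real p \<noteq> 0"
    using \<open>p \<noteq> 0\<close> by (subst map_poly_eq_0_iff) auto
  fix z assume z: "poly (map_poly complex_of_real p) z = 0"
  show "bounded_below (\<lambda>x. T x - z *\<^sub>C x)"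
  proof (cases "Im z = 0")
    case True
    then have "z = complex_of_real (Re z)"
      by (simp add: complex_eq_iff)
    with z p have "z \<notin> op_spectrum T"
      unfolding real_spectrum_def by (metis mem_Collect_eq of_real_eq_0_iff poly_map_poly_of_real)
    then show ?thesis by (rule bounded_below_if_not_in_spectrum)
  next
    case False
    then show ?thesis by (rule hermitian_minus_nonreal_bounded_below[OF T])
  qed
qed

text \<open>Vectors that almost attain the norm of \<open>S\<close> are approximate eigenvectors of \<open>S\<^sup>2\<close> for the eigenvalue
\<open>\<nu> = \<parallel>S\<parallel>\<^sup>2\<close>, because \<open>\<parallel>S\<^sup>2x - \<nu>x\<parallel>\<^sup>2 \<le> \<nu>(\<nu>\<parallel>x\<parallel>\<^sup>2 - \<parallel>Sx\<parallel>\<^sup>2)\<close>. A lower bound on the left would therefore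
push \<open>\<parallel>S\<parallel>\<^sup>2\<close> below \<open>\<nu>\<close>.\<close>

lemma hermitian_square_minus_norm_not_bounded_below:
  assumes S: "hermitian_op S" and nontrivial: "(v::'a::chilbert_space) \<noteq> 0"
  shows "\<not> bounded_below (\<lambda>x::'a. S (S x) - (onorm S)\<^sup>2 *\<^sub>R x)"
proof
  assume "bounded_below (\<lambda>x. S (S x) - (onorm S)\<^sup>2 *\<^sub>R x)"
  then obtain c where c: "0 < c" "\<And>x. c * norm x \<le> norm (S (S x) - (onorm S)\<^sup>2 *\<^sub>R x)"
    by (auto simp: bounded_below_def)
  define \<nu> where "\<nu> = (onorm S)\<^sup>2"
  note bS = hermitian_op_bounded_clinear[OF S]
  have norm_S: "(norm (S x))\<^sup>2 \<le> \<nu> * (norm x)\<^sup>2" for x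
    using power_mono[OF bounded_clinear_norm_le[OF bS, of x], of 2]
    by (simp add: \<nu>_def power_mult_distrib)
  have *: "c\<^sup>2 * (norm x)\<^sup>2 \<le> \<nu> * (\<nu> * (norm x)\<^sup>2 - (norm (S x))\<^sup>2)" for x
  proof -
    have "c\<^sup>2 * (norm x)\<^sup>2 = (c * norm x)\<^sup>2"
      by (simp add: power_mult_distrib)
    also have "\<dots> \<le> (norm (S (S x) - \<nu> *\<^sub>R x))\<^sup>2"
      using c by (intro power_mono) (auto simp: \<nu>_def)
    also have "\<dots> = (norm (S (S x)))\<^sup>2 - 2 * \<nu> * (norm (S x))\<^sup>2 + \<nu>\<^sup>2 * (norm x)\<^sup>2"
      unfolding power2_norm_eq_inner
      by (simp add: inner_diff hermitian_op_inner[OF S, of "S x" x] inner_commute[of x "S (S x)"]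
          power2_eq_square algebra_simps)
    also have "\<dots> \<le> \<nu> * (norm (S x))\<^sup>2 - 2 * \<nu> * (norm (S x))\<^sup>2 + \<nu>\<^sup>2 * (norm x)\<^sup>2"
      using norm_S[of "S x"] by simp
    also have "\<dots> = \<nu> * (\<nu> * (norm x)\<^sup>2 - (norm (S x))\<^sup>2)"
      by (simp add: power2_eq_square algebra_simps)
    finally show ?thesis .
  qed
  have "\<nu> \<noteq> 0"
    using *[of v] c(1) nontrivial by (auto simp: mult_le_0_iff)
  then have \<nu>: "0 < \<nu>" by (simp add: \<nu>_def)
  define \<mu> where "\<mu> = \<nu> - c\<^sup>2 / \<nu>"
  have S_le: "(norm (S x))\<^sup>2 \<le> \<mu> * (norm x)\<^sup>2" for x
    using *[of x] \<nu> by (simp add: \<mu>_def field_simps power2_eq_square)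
  have "0 \<le> \<mu> * (norm v)\<^sup>2"
    using S_le[of v] zero_le_power2 order_trans by blast
  then have \<mu>: "0 \<le> \<mu>"
    using nontrivial by (simp add: zero_le_mult_iff)
  have "norm (S x) \<le> sqrt \<mu> * norm x" for x
    using S_le[of x] real_le_rsqrt[of "norm (S x)" "\<mu> * (norm x)\<^sup>2"]
    by (simp add: real_sqrt_mult)
  then have "onorm S \<le> sqrt \<mu>"
    by (intro onorm_bound) (use \<mu> in auto)
  then have "\<nu> \<le> \<mu>"
    unfolding \<nu>_def using power_mono[of "onorm S" "sqrt \<mu>" 2]
      onorm_pos_le[OF bounded_clinear_bounded_linear[OF bS]] \<mu> by simp
  moreover have "\<mu> < \<nu>"
    using \<nu> c(1) by (simp add: \<mu>_def)
  ultimately show False by simp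
qed

text \<open>Otherwise \<open>p\<^sup>2 - \<parallel>p(T)\<parallel>\<^sup>2\<close> would be a nonzero polynomial without roots in the real spectrum, and
\<open>p(T)\<^sup>2 - \<parallel>p(T)\<parallel>\<^sup>2\<close> would be bounded below. The vector \<open>v\<close> excludes the zero space, whose operators
have empty spectrum.\<close>

lemma hermitian_op_poly_norm_root:
  assumes T: "hermitian_op T" and nontrivial: "(v::'a::chilbert_space) \<noteq> 0"
    and nz: "p * p \<noteq> [:(onorm (op_poly p T))\<^sup>2:]"
  shows "\<exists>t\<in>real_spectrum (T::'a \<Rightarrow> 'a). \<bar>poly p t\<bar> = onorm (op_poly p T)"
proof -
  note bT = hermitian_op_bounded_clinear[OF T]
  let ?n = "onorm (op_poly p T)"
  let ?q = "p * p - [:?n\<^sup>2:]"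
  have "op_poly ?q T = (\<lambda>x. op_poly p T (op_poly p T x) - ?n\<^sup>2 *\<^sub>R x)"
    by (rule ext) (simp add: op_poly_diff[OF bT] op_poly_mult[OF bT] op_poly_pCons[OF bT]
        bounded_clinear_simps[OF bT])
  then have "\<not> bounded_below (op_poly ?q T)"
    using hermitian_square_minus_norm_not_bounded_below[OF hermitian_op_poly[OF T] nontrivial] by simp
  then obtain t where t: "t \<in> real_spectrum T" "poly ?q t = 0"
    using hermitian_op_poly_bounded_below[OF T, of ?q] nz by auto
  have "(poly p t)\<^sup>2 = ?n\<^sup>2"
    using t(2) by (simp add: power2_eq_square)
  then have "\<bar>poly p t\<bar> = ?n"
    using onorm_pos_le[OF bounded_clinear_bounded_linear[OF bounded_clinear_op_poly[OF bT]], of p]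
    by (metis abs_of_nonneg power2_eq_iff abs_minus_cancel)
  with t(1) show ?thesis by blast
qed

lemma norm_op_poly_le_spectrum:
  assumes T: "hermitian_op T" and b: "0 \<le> b"
    and p: "\<And>t. t \<in> real_spectrum T \<Longrightarrow> \<bar>poly p t\<bar> \<le> b"
  shows "norm (op_poly p T x) \<le> b * norm x"
proof (cases "x = 0")
  case True
  then show ?thesis
    by (simp add: bounded_clinear_simps[OF bounded_clinear_op_poly[OF hermitian_op_bounded_clinear[OF T]]])
next
  case False
  let ?n = "onorm (op_poly p T)"
  have n_pos: "0 \<le> ?n"
    by (intro onorm_pos_le bounded_clinear_bounded_linear bounded_clinear_op_poly
        hermitian_op_bounded_clinear[OF T])
  have "?n \<le> b"
  proof (cases "p * p = [:?n\<^sup>2:]")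
    case True
    \<comment> \<open>Here \<open>p\<close> is constant, and any point of the spectrum will do.\<close>
    obtain t where t: "t \<in> real_spectrum T"
      using hermitian_op_poly_norm_root[OF T False, of "[:0, 1:]"] by auto
    have "(poly p t)\<^sup>2 = ?n\<^sup>2"
      using arg_cong[OF True, of "\<lambda>q. poly q t"] by (simp add: power2_eq_square)
    then have "\<bar>poly p t\<bar> = ?n"
      using n_pos by (metis abs_of_nonneg power2_eq_iff abs_minus_cancel)
    then show ?thesis using p[OF t] by simp
  next
    case False': False
    show ?thesis
      using hermitian_op_poly_norm_root[OF T False False'] p by fastforce
  qed
  then show ?thesis
    using bounded_clinear_norm_le[OF bounded_clinear_op_poly[OF hermitian_op_bounded_clinear[OF T]], of p x]
      mult_right_mono[of ?n b "norm x"] by simp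
qed

section \<open>Continuous functional calculus\<close>

lemma onorm_tendsto_imp_pointwise:
  assumes P: "\<And>n. bounded_clinear (P n)" and S: "bounded_clinear S"
    and lim: "(\<lambda>n. onorm (\<lambda>x. P n x - S x)) \<longlonglongrightarrow> 0"
  shows "(\<lambda>n. P n x) \<longlonglongrightarrow> S x"
proof -
  have "(\<lambda>n. P n x - S x) \<longlonglongrightarrow> 0"
  proof (rule Lim_null_comparison)
    show "\<forall>\<^sub>F n in sequentially. norm (P n x - S x) \<le> onorm (\<lambda>x. P n x - S x) * norm x"
      using bounded_clinear_norm_le[OF bounded_clinear_diff[OF P S]] by simp
    show "(\<lambda>n. onorm (\<lambda>x. P n x - S x) * norm x) \<longlonglongrightarrow> 0"
      using tendsto_mult_right[OF lim, of "norm x"] by simp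
  qed
  then show ?thesis by (simp add: LIM_zero_iff)
qed

lemma operator_Cauchy_limit:
  fixes P :: "nat \<Rightarrow> 'a::chilbert_space \<Rightarrow> 'a"
  assumes P: "\<And>n. bounded_clinear (P n)"
    and Cauchy: "\<And>e. 0 < e \<Longrightarrow> \<exists>N. \<forall>m\<ge>N. \<forall>n\<ge>N. \<forall>x. norm (P m x - P n x) \<le> e * norm x"
  obtains S where "bounded_clinear S" "(\<lambda>n. onorm (\<lambda>x. P n x - S x)) \<longlonglongrightarrow> 0"
proof -
  have "\<exists>y. (\<lambda>n. P n x) \<longlonglongrightarrow> y" for x
  proof -
    have "Cauchy (\<lambda>n. P n x)"
    proof (rule metric_CauchyI)
      fix e :: real assume "0 < e"
      then obtain N where N: "\<And>m n y. N \<le> m \<Longrightarrow> N \<le> n \<Longrightarrow>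
          norm (P m y - P n y) \<le> e / (norm x + 1) * norm y"
        using Cauchy[of "e / (norm x + 1)"] by (auto simp: add_nonneg_pos)
      have "norm x < norm x + 1" by simp
      then have "e / (norm x + 1) * norm x < e"
        using \<open>0 < e\<close> by (simp add: add_nonneg_pos divide_less_eq)
      then show "\<exists>M. \<forall>m\<ge>M. \<forall>n\<ge>M. dist (P m x) (P n x) < e"
        unfolding dist_norm using N[where y = x] by (meson le_less_trans)
    qed
    then show ?thesis
      using Cauchy_convergent convergent_def by blast
  qed
  then obtain S where S: "\<And>x. (\<lambda>n. P n x) \<longlonglongrightarrow> S x"
    by metis
  have close: "\<exists>N. \<forall>n\<ge>N. \<forall>x. norm (P n x - S x) \<le> e * norm x" if e: "0 < e" for e
  proof -
    obtain N where N: "\<And>m n x. N \<le> m \<Longrightarrow> N \<le> n \<Longrightarrow> norm (P n x - P m x) \<le> e * norm x"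
      using Cauchy[OF e] by blast
    have "norm (P n x - S x) \<le> e * norm x" if "N \<le> n" for n x
    proof (rule LIMSEQ_le_const2)
      show "(\<lambda>m. norm (P n x - P m x)) \<longlonglongrightarrow> norm (P n x - S x)"
        by (intro tendsto_intros S)
      show "\<exists>M. \<forall>m\<ge>M. norm (P n x - P m x) \<le> e * norm x"
        using N[OF _ that] by blast
    qed
    then show ?thesis by blast
  qed
  obtain N where N: "norm (P N x - S x) \<le> norm x" for x
    using close[of 1] by auto
  have bS: "bounded_clinear S"
  proof (rule bounded_clinearI[where K = "onorm (P N) + 1"])
    show "S (x + y) = S x + S y" for x y
      using tendsto_add[OF S[of x] S[of y]] S[of "x + y"]
      by (simp add: bounded_clinear_simps[OF P] LIMSEQ_unique)
    show "S (c *\<^sub>C x) = c *\<^sub>C S x" for c x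
      using bounded_linear.tendsto[OF bounded_clinear_bounded_linear[OF bounded_clinear_scaleC] S[of x], of c]
        S[of "c *\<^sub>C x"]
      by (simp add: bounded_clinear_simps[OF P] LIMSEQ_unique)
    show "norm (S x) \<le> (onorm (P N) + 1) * norm x" for x
      using N[of x] bounded_clinear_norm_le[OF P, of N x] norm_triangle_sub[of "S x" "P N x"]
      by (simp add: algebra_simps norm_minus_commute)
  qed
  have "(\<lambda>n. onorm (\<lambda>x. P n x - S x)) \<longlonglongrightarrow> 0"
  proof (rule LIMSEQ_I)
    fix e :: real assume e: "0 < e"
    then obtain M where M: "\<And>n x. M \<le> n \<Longrightarrow> norm (P n x - S x) \<le> e / 2 * norm x"
      using close[of "e / 2"] by auto
    have "norm (onorm (\<lambda>x. P n x - S x) - 0) < e" if "M \<le> n" for n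
    proof -
      have "onorm (\<lambda>x. P n x - S x) \<le> e / 2"
        by (rule onorm_bound) (use M[OF that] e in auto)
      moreover have "0 \<le> onorm (\<lambda>x. P n x - S x)"
        by (intro onorm_pos_le bounded_clinear_bounded_linear bounded_clinear_diff P bS)
      ultimately show ?thesis using e by simp
    qed
    then show "\<exists>N. \<forall>n\<ge>N. norm (onorm (\<lambda>x. P n x - S x) - 0) < e" by blast
  qed
  with bS show ?thesis by (rule that)
qed

text \<open>Polynomials that converge uniformly on the spectrum give operators that form a Cauchy sequence in
norm, by the norm estimate above. The limit does not depend on the sequence, so it satisfies the
defining description of \<open>op_fun f T\<close>. One approximating sequence has to be given: without any, the
description would hold for every bounded operator. The rest of the text reasons only with pointwise
limits.\<close>

lemma hermitian_op_fun_limit: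
  fixes T :: "'a::chilbert_space \<Rightarrow> 'a"
  assumes T: "hermitian_op T"
    and p: "uniform_limit (real_spectrum T) (\<lambda>n. poly (p n)) f sequentially"
  shows "bounded_clinear (op_fun f T)" "(\<lambda>n. op_poly (p n) T x) \<longlonglongrightarrow> op_fun f T x"
proof -
  note bT = hermitian_op_bounded_clinear[OF T]
  note bP = bounded_clinear_op_poly[OF bT]
  have approx: "\<exists>N. \<forall>m\<ge>N. \<forall>n\<ge>N. \<forall>x. norm (op_poly (q m) T x - op_poly (q n) T x) \<le> e * norm x"
    if q: "uniform_limit (real_spectrum T) (\<lambda>n. poly (q n)) f sequentially" and e: "0 < e"
    for q e
  proof -
    from uniform_limitD[OF q, of "e / 2"] e
    obtain N where N: "\<And>n t. N \<le> n \<Longrightarrow> t \<in> real_spectrum T \<Longrightarrow> dist (poly (q n) t) (f t) < e / 2"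
      by (auto simp: eventually_sequentially)
    have "norm (op_poly (q m) T x - op_poly (q n) T x) \<le> e * norm x" if "N \<le> m" "N \<le> n" for m n x
    proof -
      have "\<bar>poly (q m - q n) t\<bar> \<le> e" if "t \<in> real_spectrum T" for t
        using N[OF \<open>N \<le> m\<close> that] N[OF \<open>N \<le> n\<close> that] unfolding dist_real_def poly_diff
        by linarith
      from norm_op_poly_le_spectrum[OF T _ this] e show ?thesis
        by (simp add: op_poly_diff[OF bT])
    qed
    then show ?thesis by blast
  qed
  define is_fun where "is_fun S \<longleftrightarrow> bounded_clinear S \<and>
     (\<forall>p :: nat \<Rightarrow> real poly.
        uniform_limit (real_spectrum T) (\<lambda>n. poly (p n)) f sequentially \<longrightarrow>
        (\<lambda>n. onorm (\<lambda>x. op_poly (p n) T x - S x)) \<longlonglongrightarrow> 0)" for S :: "'a \<Rightarrow> 'a"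
  have pointwise: "(\<lambda>n. op_poly (p n) T x) \<longlonglongrightarrow> S x" if "is_fun S" for S x
    by (rule onorm_tendsto_imp_pointwise[OF bP]) (use that p in \<open>simp_all add: is_fun_def\<close>)
  obtain S where S: "bounded_clinear S" "(\<lambda>n. onorm (\<lambda>x. op_poly (p n) T x - S x)) \<longlonglongrightarrow> 0"
    by (rule operator_Cauchy_limit[of "\<lambda>n. op_poly (p n) T", OF bP approx[OF p]]) blast+
  have "is_fun S"
    unfolding is_fun_def
  proof (intro conjI allI impI S(1))
    fix q :: "nat \<Rightarrow> real poly"
    assume q: "uniform_limit (real_spectrum T) (\<lambda>n. poly (q n)) f sequentially"
    \<comment> \<open>Interleaving the two sequences shows that they have the same limit.\<close>
    define h where "h n = (if even n then p (n div 2) else q (n div 2))" for n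
    have "uniform_limit (real_spectrum T) (\<lambda>n. poly (h n)) f sequentially"
    proof (rule uniform_limitI)
      fix e :: real assume e: "0 < e"
      obtain N M where N: "\<forall>n\<ge>N. \<forall>t\<in>real_spectrum T. dist (poly (p n) t) (f t) < e"
        and M: "\<forall>n\<ge>M. \<forall>t\<in>real_spectrum T. dist (poly (q n) t) (f t) < e"
        using uniform_limitD[OF p e] uniform_limitD[OF q e] by (auto simp: eventually_sequentially)
      have "\<forall>t\<in>real_spectrum T. dist (poly (h n) t) (f t) < e" if "2 * (N + M) \<le> n" for n
      proof -
        have "N \<le> n div 2" "M \<le> n div 2" using that by simp_all
        with N M show ?thesis by (simp add: h_def)
      qed
      then show "\<forall>\<^sub>F n in sequentially. \<forall>t\<in>real_spectrum T. dist (poly (h n) t) (f t) < e"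
        unfolding eventually_sequentially by blast
    qed
    then obtain R where R: "bounded_clinear R" "(\<lambda>n. onorm (\<lambda>x. op_poly (h n) T x - R x)) \<longlonglongrightarrow> 0"
      by (rule operator_Cauchy_limit[of "\<lambda>n. op_poly (h n) T", OF bP approx]) blast+
    have "strict_mono (\<lambda>n::nat. 2 * n)" "strict_mono (\<lambda>n::nat. 2 * n + 1)"
      by (simp_all add: strict_mono_def)
    note LIMSEQ_subseq_LIMSEQ[OF R(2) this(1)] LIMSEQ_subseq_LIMSEQ[OF R(2) this(2)]
    then have even: "(\<lambda>n. onorm (\<lambda>x. op_poly (p n) T x - R x)) \<longlonglongrightarrow> 0"
      and odd: "(\<lambda>n. onorm (\<lambda>x. op_poly (q n) T x - R x)) \<longlonglongrightarrow> 0"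
      by (simp_all add: o_def h_def)
    have "R = S"
      by (rule ext, rule LIMSEQ_unique[OF onorm_tendsto_imp_pointwise[OF bP R(1) even]
            onorm_tendsto_imp_pointwise[OF bP S]])
    then show "(\<lambda>n. onorm (\<lambda>x. op_poly (q n) T x - S x)) \<longlonglongrightarrow> 0"
      using odd by simp
  qed
  moreover have "op_fun f T = (THE S. is_fun S)"
    by (simp add: op_fun_def is_fun_def real_spectrum_def)
  moreover have "(THE S. is_fun S) = S"
    using \<open>is_fun S\<close>
    by (rule the_equality[where P = is_fun]) (rule ext, rule LIMSEQ_unique[OF pointwise pointwise[OF \<open>is_fun S\<close>]])
  ultimately show "bounded_clinear (op_fun f T)" "(\<lambda>n. op_poly (p n) T x) \<longlonglongrightarrow> op_fun f T x"
    using S(1) pointwise by simp_all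
qed

lemma polynomial_uniform_approximation:
  fixes f :: "real \<Rightarrow> real"
  assumes "continuous_on {a..b} f"
  obtains p where "uniform_limit {a..b} (\<lambda>n. poly (p n)) f sequentially"
proof -
  have "\<exists>p. \<forall>t\<in>{a..b}. dist (poly p t) (f t) < 1 / real (Suc n)" for n
  proof -
    obtain g where g: "real_polynomial_function g" "\<And>t. t \<in> {a..b} \<Longrightarrow> \<bar>f t - g t\<bar> < 1 / real (Suc n)"
      using Stone_Weierstrass_real_polynomial_function[of "{a..b}" f "1 / real (Suc n)"] assms
      by auto
    obtain c m where "g = (\<lambda>t. \<Sum>i\<le>m. c i * t ^ i)"
      using g(1) by (auto simp: real_polynomial_function_iff_sum)
    then have "g = poly (\<Sum>i\<le>m. monom (c i) i)"
      by (auto simp: poly_sum poly_monom)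
    with g(2) show ?thesis
      unfolding dist_real_def by (metis abs_minus_commute)
  qed
  then obtain p where p: "\<And>n t. t \<in> {a..b} \<Longrightarrow> dist (poly (p n) t) (f t) < 1 / real (Suc n)"
    by metis
  have "uniform_limit {a..b} (\<lambda>n. poly (p n)) f sequentially"
  proof (rule uniform_limitI)
    fix e :: real assume "0 < e"
    have "\<forall>\<^sub>F n in sequentially. 1 / real (Suc n) < e"
      by (rule order_tendstoD(2)[OF LIMSEQ_Suc[OF lim_1_over_n] \<open>0 < e\<close>])
    then show "\<forall>\<^sub>F n in sequentially. \<forall>t\<in>{a..b}. dist (poly (p n) t) (f t) < e"
      by (rule eventually_mono) (use p less_trans in blast)
  qed
  then show ?thesis by (rule that)
qed

lemma positive_op_bounded_clinear: "positive_op T \<Longrightarrow> bounded_clinear T"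
  by (simp add: positive_op_def)

lemma positive_op_inner: "positive_op T \<Longrightarrow> 0 \<le> inner (T x) x"
  by (simp add: positive_op_def complex_nonneg_Reals_iff inner_eq_Re_cinner)

text \<open>Polarisation: the quadratic form of \<open>T\<close> is real at \<open>x + y\<close> and at \<open>x + \<i>y\<close>.\<close>

lemma positive_op_hermitian:
  assumes T: "positive_op T"
  shows "hermitian_op T"
proof -
  note bT = positive_op_bounded_clinear[OF T]
  have real: "Im (cinner (T x) x) = 0" for x
    using T by (simp add: positive_op_def complex_nonneg_Reals_iff)
  have "cinner (T x) y = cinner x (T y)" for x y
  proof -
    have "Im (cinner (T x) y) + Im (cinner (T y) x) = 0"
      using real[of "x + y"] by (simp add: bounded_clinear_simps[OF bT] cinner_linear real)
    moreover have "Re (cinner (T x) y) = Re (cinner (T y) x)"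
      using real[of "x + \<i> *\<^sub>C y"]
      by (simp add: bounded_clinear_simps[OF bT] cinner_linear real)
    ultimately have "cinner (T x) y = cnj (cinner (T y) x)"
      by (simp add: complex_eq_iff)
    then show ?thesis by (simp flip: cinner_commute)
  qed
  with bT show ?thesis by (simp add: hermitian_op_def)
qed

lemma hermitian_cinner_real:
  assumes "hermitian_op T"
  shows "cinner (T x) x = complex_of_real (inner (T x) x)"
proof -
  have "cinner (T x) x = cnj (cinner (T x) x)"
    using cinner_commute[of "T x" x] hermitian_opD[OF assms, of x x] by simp
  then show ?thesis
    by (simp add: complex_eq_iff inner_eq_Re_cinner)
qed

lemma positive_opI:
  assumes "hermitian_op T" "\<And>x. 0 \<le> inner (T x) x"
  shows "positive_op T"
  using assms hermitian_cinner_real[OF assms(1)]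
  by (simp add: positive_op_def hermitian_op_bounded_clinear complex_nonneg_Reals_iff)

lemma positive_op_minus_scaleR_coercive:
  assumes "positive_op T" "t < 0"
  shows "- t * (norm x)\<^sup>2 \<le> inner (T x - t *\<^sub>R x) x"
  using positive_op_inner[OF assms(1), of x] by (simp add: inner_diff power2_norm_eq_inner)

text \<open>The operators \<open>T - t\<close> for \<open>t < 0\<close> and \<open>t - T\<close> for \<open>t > \<parallel>T\<parallel>\<close> are coercive, hence invertible. The
inclusion makes the Weierstrass theorem applicable and keeps the spectrum where powers with positive
exponent are continuous.\<close>

lemma positive_op_real_spectrum:
  assumes T: "positive_op T"
  shows "real_spectrum T \<subseteq> {0..onorm T}"
proof
  note bT = positive_op_bounded_clinear[OF T]
  fix t assume t: "t \<in> real_spectrum T"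
  have "0 \<le> t"
  proof (rule ccontr)
    assume "\<not> 0 \<le> t"
    then have "0 < - t" and "\<And>x. - t * (norm x)\<^sup>2 \<le> inner (T x - t *\<^sub>R x) x"
      using positive_op_minus_scaleR_coercive[OF T] by auto
    then obtain S where "bounded_clinear S" "\<And>x. S (T x - t *\<^sub>R x) = x" "\<And>x. T (S x) - t *\<^sub>R S x = x"
      using coercive_inverse[OF bounded_clinear_diff[OF bT bounded_clinear_scaleR]] by blast
    then have "t \<notin> real_spectrum T"
      by (auto simp: real_spectrum_def op_spectrum_def scaleC_of_real)
    with t show False by simp
  qed
  moreover have "t \<le> onorm T"
  proof (rule ccontr)
    assume "\<not> t \<le> onorm T"
    then have "0 < t - onorm T" by simp
    moreover have "(t - onorm T) * (norm x)\<^sup>2 \<le> inner (t *\<^sub>R x - T x) x" for x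
    proof -
      have "inner (T x) x \<le> norm (T x) * norm x"
        by (rule norm_cauchy_schwarz)
      also have "\<dots> \<le> onorm T * norm x * norm x"
        by (intro mult_right_mono bounded_clinear_norm_le[OF bT]) simp
      finally show ?thesis
        by (simp add: inner_diff power2_norm_eq_inner[symmetric] power2_eq_square algebra_simps)
    qed
    ultimately obtain S where S: "bounded_clinear S"
        "\<And>x. S (t *\<^sub>R x - T x) = x" "\<And>x. t *\<^sub>R S x - T (S x) = x"
      using coercive_inverse[OF bounded_clinear_diff[OF bounded_clinear_scaleR bT]] by blast
    define R where "R x = S (- x)" for x
    have "bounded_clinear R"
      unfolding R_def
      using bounded_clinear_compose[OF S(1) bounded_clinear_scaleR[of "- 1"]] by simp
    moreover have "R (T x - t *\<^sub>R x) = x" "T (R x) - t *\<^sub>R R x = x" for x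
      using S(2)[of x] S(3)[of "- x"] by (auto simp: R_def algebra_simps)
    ultimately have "t \<notin> real_spectrum T"
      by (auto simp: real_spectrum_def op_spectrum_def scaleC_of_real)
    with t show False by simp
  qed
  ultimately show "t \<in> {0..onorm T}" by simp
qed

lemma op_poly_nonneg:
  assumes T: "positive_op T" and p: "\<And>t. t \<in> {0..onorm T} \<Longrightarrow> 0 \<le> poly p t"
  shows "0 \<le> inner (op_poly p T x) x"
proof -
  note hT = positive_op_hermitian[OF T]
  note bT = positive_op_bounded_clinear[OF T]
  have "compact (poly p ` {0..onorm T})"
    by (intro compact_continuous_image continuous_intros compact_Icc)
  then obtain c where c: "0 < c" "\<And>t. t \<in> {0..onorm T} \<Longrightarrow> \<bar>poly p t\<bar> \<le> c"
    using compact_imp_bounded bounded_pos by (metis (no_types, lifting) imageI real_norm_def)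
  \<comment> \<open>Since \<open>0 \<le> p \<le> c\<close> on the spectrum, \<open>c - p(T)\<close> has norm at most \<open>c\<close>.\<close>
  have "norm (op_poly ([:c:] - p) T x) \<le> c * norm x"
  proof (rule norm_op_poly_le_spectrum[OF hT])
    fix t assume "t \<in> real_spectrum T"
    then have "t \<in> {0..onorm T}"
      using positive_op_real_spectrum[OF T] by blast
    then show "\<bar>poly ([:c:] - p) t\<bar> \<le> c"
      using p[of t] c(2)[of t] by simp
  qed (use c in simp)
  then have "inner (op_poly ([:c:] - p) T x) x \<le> c * norm x * norm x"
    by (meson mult_right_mono norm_cauchy_schwarz norm_ge_zero order_trans)
  moreover have "op_poly ([:c:] - p) T x = c *\<^sub>R x - op_poly p T x"
    by (simp add: op_poly_diff[OF bT] op_poly_pCons[OF bT] bounded_clinear_simps[OF bT])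
  ultimately show ?thesis
    by (simp add: inner_diff power2_norm_eq_inner[symmetric] power2_eq_square)
qed

lemma op_fun_approx:
  assumes T: "positive_op T" and p: "uniform_limit {0..onorm T} (\<lambda>n. poly (p n)) f sequentially"
  shows "bounded_clinear (op_fun f T)" "(\<lambda>n. op_poly (p n) T x) \<longlonglongrightarrow> op_fun f T x"
  using hermitian_op_fun_limit[OF positive_op_hermitian[OF T]
      uniform_limit_on_subset[OF p positive_op_real_spectrum[OF T]]] .

lemma op_fun_poly:
  assumes "positive_op T"
  shows "op_fun (poly p) T = op_poly p T"
proof
  fix x
  have "uniform_limit {0..onorm T} (\<lambda>n::nat. poly p) (poly p) sequentially"
    by (intro uniform_limit_intros)
  from op_fun_approx(2)[OF assms this, of x] show "op_fun (poly p) T x = op_poly p T x"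
    by (simp add: LIMSEQ_const_iff)
qed

lemma op_fun_cong:
  assumes T: "positive_op T" and f: "continuous_on {0..onorm T} f"
    and fg: "\<And>t. t \<in> {0..onorm T} \<Longrightarrow> f t = g t"
  shows "op_fun f T = op_fun g T"
proof
  fix x
  obtain p where p: "uniform_limit {0..onorm T} (\<lambda>n. poly (p n)) f sequentially"
    using polynomial_uniform_approximation[OF f] .
  then have "uniform_limit {0..onorm T} (\<lambda>n. poly (p n)) g sequentially"
    using uniform_limit_cong'[of "{0..onorm T}" "\<lambda>n. poly (p n)" _ f g] fg by simp
  from op_fun_approx(2)[OF T p] op_fun_approx(2)[OF T this] show "op_fun f T x = op_fun g T x"
    by (rule LIMSEQ_unique)
qed

lemma op_fun_mono:
  assumes T: "positive_op T"
    and f: "continuous_on {0..onorm T} f" and g: "continuous_on {0..onorm T} g"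
    and le: "\<And>t. t \<in> {0..onorm T} \<Longrightarrow> f t \<le> g t"
  shows "inner (op_fun f T x) x \<le> inner (op_fun g T x) x"
proof -
  note bT = positive_op_bounded_clinear[OF T]
  obtain p where p: "uniform_limit {0..onorm T} (\<lambda>n. poly (p n)) f sequentially"
    using polynomial_uniform_approximation[OF f] .
  obtain q where q: "uniform_limit {0..onorm T} (\<lambda>n. poly (q n)) g sequentially"
    using polynomial_uniform_approximation[OF g] .
  show ?thesis
  proof (rule field_le_epsilon)
    fix e :: real assume "0 < e"
    define d where "d = e / (2 * ((norm x)\<^sup>2 + 1))"
    have "(norm x)\<^sup>2 < (norm x)\<^sup>2 + 1" by simp
    then have d: "0 < d" "2 * d * (norm x)\<^sup>2 \<le> e"
      using \<open>0 < e\<close> by (auto simp: d_def add_nonneg_pos divide_le_eq)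
    have "\<forall>\<^sub>F n in sequentially. inner (op_poly (p n) T x) x \<le> inner (op_poly (q n) T x) x + e"
      using uniform_limitD[OF p d(1)] uniform_limitD[OF q d(1)]
    proof eventually_elim
      case (elim n)
      have "0 \<le> inner (op_poly (q n - p n + [:2 * d:]) T x) x"
      proof (rule op_poly_nonneg[OF T])
        fix t assume "t \<in> {0..onorm T}"
        then show "0 \<le> poly (q n - p n + [:2 * d:]) t"
          using elim le[of t] by (fastforce simp: dist_real_def abs_less_iff)
      qed
      also have "op_poly (q n - p n + [:2 * d:]) T x
          = op_poly (q n) T x - op_poly (p n) T x + (2 * d) *\<^sub>R x"
        by (simp add: op_poly_add[OF bT] op_poly_diff[OF bT] op_poly_pCons[OF bT]
            bounded_clinear_simps[OF bT])
      finally show ?case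
        using d(2) by (simp add: inner_add inner_diff power2_norm_eq_inner)
    qed
    then show "inner (op_fun f T x) x \<le> inner (op_fun g T x) x + e"
      by (intro tendsto_le[OF sequentially_bot])
        (use op_fun_approx(2)[OF T p, of x] op_fun_approx(2)[OF T q, of x]
          in \<open>auto intro!: tendsto_intros\<close>)
  qed
qed

lemma op_fun_hermitian:
  assumes T: "positive_op T" and f: "continuous_on {0..onorm T} f"
  shows "hermitian_op (op_fun f T)"
proof -
  obtain p where p: "uniform_limit {0..onorm T} (\<lambda>n. poly (p n)) f sequentially"
    using polynomial_uniform_approximation[OF f] .
  have real_inner: "inner (op_fun f T x) y = inner x (op_fun f T y)" for x y
  proof (rule LIMSEQ_unique)
    show "(\<lambda>n. inner (op_poly (p n) T x) y) \<longlonglongrightarrow> inner (op_fun f T x) y"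
      by (intro tendsto_intros op_fun_approx(2)[OF T p])
    show "(\<lambda>n. inner (op_poly (p n) T x) y) \<longlonglongrightarrow> inner x (op_fun f T y)"
      using hermitian_op_inner[OF hermitian_op_poly[OF positive_op_hermitian[OF T]]]
      by (simp add: tendsto_inner op_fun_approx(2)[OF T p])
  qed
  note b = op_fun_approx(1)[OF T p]
  have "cinner (op_fun f T x) y = cinner x (op_fun f T y)" for x y
    using real_inner[of x y] real_inner[of "\<i> *\<^sub>C x" y]
    by (simp add: complex_eq_iff inner_eq_Re_cinner bounded_clinear_simps[OF b] cinner_scaleC_left)
  with b show ?thesis by (simp add: hermitian_op_def)
qed

lemma op_fun_positive:
  assumes T: "positive_op T" and f: "continuous_on {0..onorm T} f"
    and nonneg: "\<And>t. t \<in> {0..onorm T} \<Longrightarrow> 0 \<le> f t"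
  shows "positive_op (op_fun f T)"
proof (rule positive_opI[OF op_fun_hermitian[OF T f]])
  fix x
  show "0 \<le> inner (op_fun f T x) x"
    using op_fun_mono[OF T _ f, of "poly 0" x] nonneg
    by (simp add: op_fun_poly[OF T] continuous_on_const)
qed

text \<open>For approximations \<open>p\<close> of \<open>f\<close> and \<open>q\<close> of \<open>g\<close>, the inner product of \<open>(pq)(T)x\<close> with \<open>y\<close> is that of
\<open>q(T)x\<close> with \<open>p(T)y\<close>, where each factor converges separately.\<close>

lemma op_fun_mult:
  assumes T: "positive_op T"
    and f: "continuous_on {0..onorm T} f" and g: "continuous_on {0..onorm T} g"
  shows "op_fun (\<lambda>t. f t * g t) T x = op_fun f T (op_fun g T x)"
proof -
  obtain p where p: "uniform_limit {0..onorm T} (\<lambda>n. poly (p n)) f sequentially"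
    using polynomial_uniform_approximation[OF f] .
  obtain q where q: "uniform_limit {0..onorm T} (\<lambda>n. poly (q n)) g sequentially"
    using polynomial_uniform_approximation[OF g] .
  have "uniform_limit {0..onorm T} (\<lambda>n t. poly (p n) t * poly (q n) t) (\<lambda>t. f t * g t) sequentially"
    by (intro uniform_lim_mult p q compact_imp_bounded compact_continuous_image f g compact_Icc)
  then have pq: "uniform_limit {0..onorm T} (\<lambda>n. poly (p n * q n)) (\<lambda>t. f t * g t) sequentially"
    by (simp add: poly_mult[abs_def])
  have "inner (op_fun (\<lambda>t. f t * g t) T x) y = inner (op_fun f T (op_fun g T x)) y" for y
  proof (rule LIMSEQ_unique)
    show "(\<lambda>n. inner (op_poly (p n * q n) T x) y) \<longlonglongrightarrow> inner (op_fun (\<lambda>t. f t * g t) T x) y"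
      by (intro tendsto_intros op_fun_approx(2)[OF T pq])
    have "(\<lambda>n. inner (op_poly (q n) T x) (op_poly (p n) T y)) \<longlonglongrightarrow>
        inner (op_fun g T x) (op_fun f T y)"
      by (intro tendsto_intros op_fun_approx(2)[OF T p] op_fun_approx(2)[OF T q])
    then show "(\<lambda>n. inner (op_poly (p n * q n) T x) y) \<longlonglongrightarrow> inner (op_fun f T (op_fun g T x)) y"
      by (simp add: op_poly_mult[OF positive_op_bounded_clinear[OF T]]
          hermitian_op_inner[OF hermitian_op_poly[OF positive_op_hermitian[OF T]]]
          hermitian_op_inner[OF op_fun_hermitian[OF T f]])
  qed
  then show ?thesis
    by (metis inner_commute vector_eq_rdot)
qed

section \<open>Square roots and the modulus\<close>

lemma op_fun_sqrt_positive: "positive_op T \<Longrightarrow> positive_op (op_fun sqrt T)"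
  by (rule op_fun_positive) (auto intro: continuous_intros)

lemma op_fun_sqrt_sqrt:
  assumes T: "positive_op T"
  shows "op_fun sqrt T (op_fun sqrt T x) = T x"
proof -
  have sqrt_cont: "continuous_on {0..onorm T} sqrt"
    by (intro continuous_intros)
  have "op_fun sqrt T (op_fun sqrt T x) = op_fun (\<lambda>t. sqrt t * sqrt t) T x"
    by (rule op_fun_mult[OF T sqrt_cont sqrt_cont, symmetric])
  also have "op_fun (\<lambda>t. sqrt t * sqrt t) T = op_fun (poly [:0, 1:]) T"
    by (rule op_fun_cong[OF T]) (auto intro!: continuous_intros)
  finally show ?thesis
    by (simp add: op_fun_poly[OF T] op_poly_pCons bounded_clinear_simps positive_op_bounded_clinear[OF T])
qed

text \<open>Let \<open>p\<close> approximate the square root uniformly. Then \<open>p(T) = p(S\<^sup>2)\<close> tends to the square root of \<open>T\<close>,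
and also to \<open>S\<close>, because \<open>p(t\<^sup>2)\<close> tends to \<open>sqrt (t\<^sup>2) = t\<close> on the spectrum of \<open>S\<close>.\<close>

lemma positive_sqrt_unique:
  assumes T: "positive_op T" and S: "positive_op S" and ST: "\<And>x. S (S x) = T x"
  shows "S = op_fun sqrt T"
proof
  fix x
  note bS = positive_op_bounded_clinear[OF S]
  \<comment> \<open>The approximation has to be good at the spectrum of \<open>T\<close> and at squares from the spectrum of \<open>S\<close>.\<close>
  define M where "M = max (onorm T) ((onorm S)\<^sup>2)"
  obtain p where p: "uniform_limit {0..M} (\<lambda>n. poly (p n)) sqrt sequentially"
    by (rule polynomial_uniform_approximation[of 0 M sqrt]) (auto intro: continuous_intros)
  have "uniform_limit {0..onorm T} (\<lambda>n. poly (p n)) sqrt sequentially"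
    by (rule uniform_limit_on_subset[OF p]) (auto simp: M_def)
  from op_fun_approx(2)[OF T this]
  have lim_T: "(\<lambda>n. op_poly (p n) T x) \<longlonglongrightarrow> op_fun sqrt T x" .
  have "uniform_limit {0..onorm S} (\<lambda>n t. poly (p n) (t\<^sup>2)) (\<lambda>t. sqrt (t\<^sup>2)) sequentially"
    by (rule uniform_limit_compose'[OF p]) (auto simp: M_def intro!: max.coboundedI2 power_mono)
  then have "uniform_limit {0..onorm S} (\<lambda>n. poly (pcompose (p n) [:0, 0, 1:])) (poly [:0, 1:]) sequentially"
    by (subst (asm) uniform_limit_cong') (auto simp: poly_pcompose power2_eq_square)
  from op_fun_approx(2)[OF S this, of x]
  have lim_S: "(\<lambda>n. op_poly (pcompose (p n) [:0, 0, 1:]) S x) \<longlonglongrightarrow> S x"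
    by (simp add: op_fun_poly[OF S] op_poly_pCons[OF bS] bounded_clinear_simps[OF bS])
  have square: "op_poly [:0, 0, 1:] S = T"
    by (rule ext) (simp add: op_poly_pCons[OF bS] bounded_clinear_simps[OF bS] ST)
  have "op_poly (pcompose (p n) [:0, 0, 1:]) S x = op_poly (p n) T x" for n
    using op_poly_pcompose[OF bS bounded_clinear_op_poly[OF bS], of "p n" "[:0, 0, 1:]" x]
    by (simp only: square)
  with lim_S have "(\<lambda>n. op_poly (p n) T x) \<longlonglongrightarrow> S x"
    by simp
  with lim_T show "S x = op_fun sqrt T x"
    by (rule LIMSEQ_unique[symmetric])
qed

lemma positive_op_cadjoint_compose:
  assumes A: "bounded_clinear A"
  shows "positive_op (\<lambda>x. cadjoint A (A x))"
proof (rule positive_opI)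
  show "hermitian_op (\<lambda>x. cadjoint A (A x))"
    using bounded_clinear_compose[OF bounded_clinear_cadjoint[OF A] A]
    by (simp add: hermitian_op_def cinner_cadjoint_left[OF A] cinner_cadjoint[OF A])
  show "0 \<le> inner (cadjoint A (A x)) x" for x
    by (simp add: inner_eq_Re_cinner cinner_cadjoint_left[OF A] cinner_self)
qed

lemma op_abs_eq_sqrt:
  assumes A: "bounded_clinear A"
  shows "op_abs A = op_fun sqrt (\<lambda>x. cadjoint A (A x))"
  unfolding op_abs_def
proof (rule the_equality)
  note T = positive_op_cadjoint_compose[OF A]
  show "positive_op (op_fun sqrt (\<lambda>x. cadjoint A (A x))) \<and>
      op_fun sqrt (\<lambda>x. cadjoint A (A x)) \<circ> op_fun sqrt (\<lambda>x. cadjoint A (A x)) = cadjoint A \<circ> A"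
    using op_fun_sqrt_positive[OF T] op_fun_sqrt_sqrt[OF T] by (simp add: fun_eq_iff)
  fix S assume S: "positive_op S \<and> S \<circ> S = cadjoint A \<circ> A"
  then have "S (S x) = cadjoint A (A x)" for x
    by (metis comp_apply)
  with S show "S = op_fun sqrt (\<lambda>x. cadjoint A (A x))"
    using positive_sqrt_unique[OF T] by blast
qed

lemma op_abs_positive: "bounded_clinear A \<Longrightarrow> positive_op (op_abs A)"
  by (simp add: op_abs_eq_sqrt op_fun_sqrt_positive positive_op_cadjoint_compose)

lemma op_abs_op_abs: "bounded_clinear A \<Longrightarrow> op_abs A (op_abs A x) = cadjoint A (A x)"
  by (simp add: op_abs_eq_sqrt op_fun_sqrt_sqrt[OF positive_op_cadjoint_compose])

lemma norm_op_abs: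
  assumes A: "bounded_clinear A"
  shows "norm (op_abs A x) = norm (A x)"
proof -
  have "inner (op_abs A x) (op_abs A x) = inner (op_abs A (op_abs A x)) x"
    by (simp add: hermitian_op_inner[OF positive_op_hermitian[OF op_abs_positive[OF A]]])
  also have "\<dots> = inner (A x) (A x)"
    by (simp add: op_abs_op_abs[OF A] inner_eq_Re_cinner cinner_cadjoint_left[OF A])
  finally show ?thesis by (simp add: norm_eq)
qed

lemma op_abs_intertwine:
  assumes A: "bounded_clinear A"
  shows "A (op_abs A x) = op_abs (cadjoint A) (A x)"
proof -
  let ?B = "\<lambda>x. cadjoint A (A x)" and ?C = "\<lambda>x. A (cadjoint A x)"
  note A' = bounded_clinear_cadjoint[OF A]
  note B = positive_op_cadjoint_compose[OF A]
  have C: "positive_op ?C"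
    using positive_op_cadjoint_compose[OF A'] by (simp add: cadjoint_cadjoint[OF A])
  define M where "M = max (onorm ?B) (onorm ?C)"
  obtain p where p: "uniform_limit {0..M} (\<lambda>n. poly (p n)) sqrt sequentially"
    by (rule polynomial_uniform_approximation[of 0 M sqrt]) (auto intro: continuous_intros)
  have pB: "uniform_limit {0..onorm ?B} (\<lambda>n. poly (p n)) sqrt sequentially"
    and pC: "uniform_limit {0..onorm ?C} (\<lambda>n. poly (p n)) sqrt sequentially"
    by (rule uniform_limit_on_subset[OF p]; simp add: M_def)+
  have "(\<lambda>n. A (op_poly (p n) ?B x)) \<longlonglongrightarrow> A (op_fun sqrt ?B x)"
    by (intro bounded_linear.tendsto[OF bounded_clinear_bounded_linear[OF A]] op_fun_approx(2)[OF B pB])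
  moreover have "A (op_poly (p n) ?B x) = op_poly (p n) ?C (A x)" for n
    by (rule op_poly_intertwine[OF positive_op_bounded_clinear[OF C]
          positive_op_bounded_clinear[OF B] A refl])
  ultimately have "A (op_fun sqrt ?B x) = op_fun sqrt ?C (A x)"
    using op_fun_approx(2)[OF C pC, of "A x"] LIMSEQ_unique by simp
  then show ?thesis
    by (simp add: op_abs_eq_sqrt[OF A] op_abs_eq_sqrt[OF A'] cadjoint_cadjoint[OF A])
qed

text \<open>Write the form \<open>\<langle>Tx, y\<rangle>\<close> as \<open>\<langle>Rx, Ry\<rangle>\<close> with the square root \<open>R\<close> of \<open>T\<close>.\<close>

lemma positive_op_Cauchy_Schwarz:
  assumes T: "positive_op T"
  shows "cmod (cinner (T x) y) \<le> sqrt (inner (T x) x) * sqrt (inner (T y) y)"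
proof -
  let ?R = "op_fun sqrt T"
  have R: "cinner (?R x) (?R y) = cinner (T x) y" for x y
    using hermitian_opD[OF positive_op_hermitian[OF op_fun_sqrt_positive[OF T]], of "?R x" y]
    by (simp add: op_fun_sqrt_sqrt[OF T])
  have "norm (?R x) = sqrt (inner (T x) x)" for x
    using R[of x x] by (simp add: norm_eq_sqrt_inner inner_eq_Re_cinner)
  then show ?thesis
    using cinner_Cauchy_Schwarz[of "?R x" "?R y"] by (simp add: R)
qed

text \<open>Let \<open>B = |A|\<close> and \<open>C = |A\<^sup>*|\<close>. On the range of \<open>B\<close> the claim is Cauchy-Schwarz for the form of \<open>C\<close>:
\<open>\<langle>ABu, y\<rangle> = \<langle>CAu, y\<rangle>\<close> and \<open>\<langle>CAu, Au\<rangle> = \<langle>A\<^sup>*ABu, u\<rangle> = \<langle>B(Bu), Bu\<rangle>\<close>. A general \<open>x\<close> is \<open>Bu + du\<close> for any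
\<open>d > 0\<close>, as \<open>B + d\<close> is onto, and the error \<open>d\<langle>Au, y\<rangle>\<close> is small because \<open>\<parallel>Au\<parallel> = \<parallel>Bu\<parallel> \<le> \<parallel>x\<parallel>\<close>. This
takes the place of a polar decomposition of \<open>A\<close>.\<close>

lemma mixed_Schwarz:
  assumes A: "bounded_clinear A"
  shows "cmod (cinner (A x) y) \<le> sqrt (inner (op_abs A x) x) * sqrt (inner (op_abs (cadjoint A) y) y)"
proof (rule field_le_epsilon)
  let ?B = "op_abs A" and ?C = "op_abs (cadjoint A)"
  fix e :: real assume e: "0 < e"
  note B = op_abs_positive[OF A] and C = op_abs_positive[OF bounded_clinear_cadjoint[OF A]]
  note bB = positive_op_bounded_clinear[OF B]
  note sym = hermitian_op_inner[OF positive_op_hermitian[OF B]]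
  define d where "d = e / (norm x * norm y + 1)"
  have xy: "0 \<le> norm x * norm y" by simp
  then have d: "0 < d" "d * (norm x * norm y) \<le> e"
    using e by (auto simp: d_def add_nonneg_pos divide_le_eq)
  have "bounded_clinear (\<lambda>z. ?B z + d *\<^sub>R z)"
    by (intro bounded_clinear_add bB bounded_clinear_scaleR)
  moreover have "d * (norm z)\<^sup>2 \<le> inner (?B z + d *\<^sub>R z) z" for z
    using positive_op_minus_scaleR_coercive[OF B, of "- d" z] d(1) by simp
  ultimately obtain S where S: "\<And>z. ?B (S z) + d *\<^sub>R S z = z"
    using d(1) coercive_inverse by blast
  define u where "u = S x"
  have x: "x = ?B u + d *\<^sub>R u"
    using S[of x] by (simp add: u_def)
  have Bu: "0 \<le> inner (?B u) u" "0 \<le> inner (?B (?B u)) u"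
    using positive_op_inner[OF B, of u] sym[of "?B u" u] by simp_all
  have "cinner (A (?B u)) y = cinner (?C (A u)) y"
    by (simp add: op_abs_intertwine[OF A])
  then have "cmod (cinner (A (?B u)) y) \<le> sqrt (inner (?C (A u)) (A u)) * sqrt (inner (?C y) y)"
    using positive_op_Cauchy_Schwarz[OF C, of "A u" y] by simp
  also have "inner (?C (A u)) (A u) = inner (cadjoint A (A (?B u))) u"
    by (simp add: op_abs_intertwine[OF A] inner_eq_Re_cinner cinner_cadjoint_left[OF A])
  also have "\<dots> = inner (?B (?B (?B u))) u"
    by (simp only: op_abs_op_abs[OF A, of "?B u"])
  also have "sqrt \<dots> * sqrt (inner (?C y) y) \<le> sqrt (inner (?B x) x) * sqrt (inner (?C y) y)"
  proof (intro mult_right_mono real_sqrt_le_mono)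
    have "inner (?B x) x = inner (?B (?B (?B u))) u + 2 * d * inner (?B (?B u)) u
        + d\<^sup>2 * inner (?B u) u"
      by (simp add: x bounded_clinear_simps[OF bB] inner_add sym power2_eq_square algebra_simps)
    then show "inner (?B (?B (?B u))) u \<le> inner (?B x) x"
      using Bu d(1) by simp
  qed (use positive_op_inner[OF C] in simp)
  finally have main: "cmod (cinner (A (?B u)) y) \<le> sqrt (inner (?B x) x) * sqrt (inner (?C y) y)" .
  have "(norm (?B u))\<^sup>2 \<le> (norm x)\<^sup>2"
    using Bu d(1) unfolding power2_norm_eq_inner
    by (simp add: x inner_add inner_commute[of u "?B u"])
  then have "norm (?B u) \<le> norm x"
    by (rule power2_le_imp_le) simp
  then have "norm (A u) \<le> norm x"
    by (simp add: norm_op_abs[OF A])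
  then have "d * cmod (cinner (A u) y) \<le> d * (norm x * norm y)"
    using d(1)
    by (intro mult_left_mono order_trans[OF cinner_Cauchy_Schwarz] mult_right_mono) simp_all
  moreover have "cinner (A x) y = cinner (A (?B u)) y + complex_of_real d * cinner (A u) y"
    by (subst x) (simp add: bounded_clinear_simps[OF A] cinner_linear)
  then have "cmod (cinner (A x) y) \<le> cmod (cinner (A (?B u)) y) + d * cmod (cinner (A u) y)"
    using norm_triangle_ineq[of "cinner (A (?B u)) y" "complex_of_real d * cinner (A u) y"] d(1)
    by (simp add: norm_mult)
  ultimately show "cmod (cinner (A x) y) \<le> sqrt (inner (?B x) x) * sqrt (inner (?C y) y) + e"
    using main d(2) by linarith
qed

section \<open>Convexity of powers and McCarthy's inequality\<close>

lemma powr_tangent_line: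
  fixes a t r :: real
  assumes a: "0 \<le> a" and t: "0 \<le> t" and r: "1 \<le> r"
  shows "a powr r + r * a powr (r - 1) * (t - a) \<le> t powr r"
proof (cases "a = 0 \<or> t = 0")
  case True
  have "a powr (r - 1) * a = a powr r"
    using a by (cases "a = 0") (simp_all add: powr_diff)
  moreover have "a powr r \<le> r * a powr r"
    using r mult_right_mono[of 1 r "a powr r"] by simp
  ultimately show ?thesis
    using True by (auto simp: algebra_simps)
next
  case False
  then have "r * a powr (r - 1) * (t - a) \<le> t powr r - a powr r"
    using a t by (intro convex_on_imp_above_tangent[OF powr_convex[OF r]])
      (auto intro!: derivative_eq_intros simp: interior_open)
  then show ?thesis by simp
qed

lemma powr_Jensen_midpoint:
  fixes a b r :: real
  assumes "0 \<le> a" "0 \<le> b" "1 \<le> r"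
  shows "((a + b) / 2) powr r \<le> (a powr r + b powr r) / 2"
  using powr_tangent_line[of "(a + b) / 2" a r] powr_tangent_line[of "(a + b) / 2" b r] assms
  by (simp add: algebra_simps add_divide_distrib)

text \<open>The tangent to \<open>t\<^sup>r\<close> at \<open>a = \<langle>q(T)x, x\<rangle>\<close> lies below \<open>t\<^sup>r\<close> and turns into the polynomial \<open>l\<close> when \<open>q(t)\<close>
is inserted. By monotonicity of the calculus \<open>\<langle>q(T)\<^sup>r x, x\<rangle> \<ge> \<langle>l(T)x, x\<rangle>\<close>, and the right side is \<open>a\<^sup>r\<close>
because the tangent touches at \<open>a\<close>. The cases \<open>q = t\<close> and \<open>q = t\<^sup>2\<close> are the ones of interest.\<close>

lemma McCarthy_inequality:
  assumes T: "positive_op T" and q: "\<And>t. 0 \<le> t \<Longrightarrow> 0 \<le> poly q t"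
    and r: "1 \<le> r" and x: "norm x = 1"
  shows "inner (op_poly q T x) x powr r \<le> inner (op_fun (\<lambda>t. poly q t powr r) T x) x"
proof -
  note bT = positive_op_bounded_clinear[OF T]
  define a where "a = inner (op_poly q T x) x"
  have a: "0 \<le> a"
    unfolding a_def using q by (intro op_poly_nonneg[OF T]) auto
  define k where "k = r * a powr (r - 1)"
  define l where "l = [:a powr r - k * a:] + smult k q"
  have xx: "inner x x = 1"
    using x by (simp flip: power2_norm_eq_inner)
  have "a powr r = inner (op_poly l T x) x"
    by (simp add: l_def op_poly_add[OF bT] op_poly_smult[OF bT] op_poly_pCons[OF bT]
        bounded_clinear_simps[OF bT] inner_add xx flip: a_def)
  also have "\<dots> = inner (op_fun (poly l) T x) x"
    by (simp add: op_fun_poly[OF T])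
  also have "\<dots> \<le> inner (op_fun (\<lambda>t. poly q t powr r) T x) x"
  proof (rule op_fun_mono[OF T])
    show "continuous_on {0..onorm T} (poly l)"
      by (intro continuous_intros)
    show "continuous_on {0..onorm T} (\<lambda>t. poly q t powr r)"
      using q r by (intro continuous_on_powr' continuous_intros) auto
    show "poly l t \<le> poly q t powr r" if "t \<in> {0..onorm T}" for t
      using powr_tangent_line[OF a _ r, of "poly q t"] q[of t] that
      by (simp add: l_def k_def algebra_simps)
  qed
  finally show ?thesis by (simp add: a_def)
qed

lemma continuous_on_powr_nonneg:
  "0 < s \<Longrightarrow> continuous_on {0..b} (\<lambda>t::real. t powr s)"
  by (intro continuous_on_powr' continuous_intros) auto

lemma op_powr_positive:
  assumes T: "positive_op T" and "0 < s"
  shows "positive_op (op_powr T s)"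
  unfolding op_powr_def
  by (rule op_fun_positive[OF T continuous_on_powr_nonneg[OF \<open>0 < s\<close>]]) simp

lemma op_powr_op_powr:
  assumes T: "positive_op T" and s: "0 < s"
  shows "op_powr T s (op_powr T s x) = op_powr T (2 * s) x"
  unfolding op_powr_def
  using op_fun_mult[OF T continuous_on_powr_nonneg[OF s] continuous_on_powr_nonneg[OF s], of x]
  by (simp flip: powr_add)

lemma inner_powr_le_op_powr:
  assumes T: "positive_op T" and r: "1 \<le> r" and x: "norm x = 1"
  shows "inner (T x) x powr r \<le> inner (op_powr T r x) x"
  using McCarthy_inequality[OF T _ r x, of "[:0, 1:]"]
  by (simp add: op_powr_def op_poly_pCons bounded_clinear_simps positive_op_bounded_clinear[OF T])

text \<open>McCarthy's inequality for \<open>q = t\<^sup>2\<close>, since \<open>\<parallel>Ax\<parallel>\<^sup>2 = \<langle>|A|\<^sup>2x, x\<rangle>\<close>.\<close>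

lemma norm_powr_le_op_powr_op_abs:
  assumes A: "bounded_clinear A" and r: "1 \<le> r" and x: "norm x = 1"
  shows "norm (A x) powr (2 * r) \<le> inner (op_powr (op_abs A) (2 * r) x) x"
proof -
  note B = op_abs_positive[OF A]
  note bB = positive_op_bounded_clinear[OF B]
  have "inner (op_poly [:0, 0, 1:] (op_abs A) x) x = (norm (A x))\<^sup>2"
    by (simp add: op_poly_pCons[OF bB] bounded_clinear_simps[OF bB] op_abs_op_abs[OF A]
        inner_eq_Re_cinner cinner_cadjoint_left[OF A] cinner_self)
  then have "((norm (A x))\<^sup>2) powr r \<le> inner (op_fun (\<lambda>t. poly [:0, 0, 1:] t powr r) (op_abs A) x) x"
    using McCarthy_inequality[OF B _ r x, of "[:0, 0, 1:]"] by simp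
  also have "op_fun (\<lambda>t. poly [:0, 0, 1:] t powr r) (op_abs A) = op_powr (op_abs A) (2 * r)"
    unfolding op_powr_def
  proof (rule op_fun_cong[OF B])
    show "continuous_on {0..onorm (op_abs A)} (\<lambda>t. poly [:0, 0, 1:] t powr r)"
      using r by (intro continuous_on_powr' continuous_intros) auto
  qed (simp add: powr_mult flip: powr_add)
  finally show ?thesis
    by (simp add: powr_powr flip: powr_numeral)
qed

section \<open>The numerical radius inequality\<close>

lemma cinner_le_numerical_radius:
  assumes A: "bounded_clinear A" and x: "norm x = 1"
  shows "cmod (cinner (A x) x) \<le> numerical_radius A"
  unfolding numerical_radius_def
proof (rule cSup_upper)
  show "cmod (cinner (A x) x) \<in> insert 0 {cmod (cinner (A x) x) |x. norm x = 1}"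
    using x by blast
  have "cmod (cinner (A x) x) \<le> onorm A" if "norm x = 1" for x
    using cinner_Cauchy_Schwarz[of "A x" x] bounded_clinear_norm_le[OF A, of x] that by simp
  then show "bdd_above (insert 0 {cmod (cinner (A x) x) |x. norm x = 1})"
    by (auto intro!: bdd_aboveI[of _ "onorm A"])
qed

lemma numerical_radius_powr_le:
  assumes s: "0 < s" and b: "0 \<le> b"
    and le: "\<And>x. norm x = 1 \<Longrightarrow> cmod (cinner (A x) x) powr s \<le> b"
  shows "numerical_radius A powr s \<le> b"
proof -
  have upper: "cmod (cinner (A x) x) \<le> b powr (1 / s)" if "norm x = 1" for x
    using powr_mono2[OF _ _ le[OF that], of "1 / s"] s by (simp add: powr_powr)
  from upper have "numerical_radius A \<le> b powr (1 / s)"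
    unfolding numerical_radius_def by (intro cSup_least) auto
  moreover have "0 \<le> numerical_radius A"
    unfolding numerical_radius_def
  proof (rule cSup_upper)
    show "bdd_above (insert 0 {cmod (cinner (A x) x) |x. norm x = 1})"
      using upper by (auto intro!: bdd_aboveI[of _ "b powr (1 / s)"])
  qed simp
  ultimately show ?thesis
    using powr_mono2[of s "numerical_radius A" "b powr (1 / s)"] s b by (simp add: powr_powr)
qed

lemma inner_le_onorm:
  assumes T: "bounded_clinear T" and x: "norm x = 1"
  shows "inner (T x) x \<le> onorm T"
  using norm_cauchy_schwarz[of "T x" x] bounded_clinear_norm_le[OF T, of x] x by simp

lemma op_Re_compose_hermitian:
  assumes P: "hermitian_op P" and Q: "hermitian_op Q"
  shows "op_Re (P \<circ> Q) = (\<lambda>x. (1/2) *\<^sub>R (P (Q x) + Q (P x)))"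
proof -
  have "cadjoint (P \<circ> Q) = Q \<circ> P"
    by (rule cadjoint_eqI) (simp add: hermitian_opD[OF P] hermitian_opD[OF Q])
  then show ?thesis by (simp add: op_Re_def)
qed

theorem corollary2p8:
  fixes A :: "'a::chilbert_space \<Rightarrow> 'a" and r :: real
  assumes "bounded_clinear A"
    and "r \<ge> 1"
  shows "numerical_radius A powr (2 * r) \<le>
    1/4 * onorm (\<lambda>x. op_powr (op_abs A) (2 * r) x + op_powr (op_abs (cadjoint A)) (2 * r) x)
    + 1/2 * min (onorm (op_Re (op_powr (op_abs A) r \<circ> op_powr (op_abs (cadjoint A)) r)))
                (numerical_radius (A \<circ> A) powr r)"
proof (rule numerical_radius_powr_le)
  note A = assms(1) and r = assms(2)
  note A' = bounded_clinear_cadjoint[OF A]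
  let ?P = "op_powr (op_abs A) r" and ?Q = "op_powr (op_abs (cadjoint A)) r"
  let ?P2 = "op_powr (op_abs A) (2 * r)" and ?Q2 = "op_powr (op_abs (cadjoint A)) (2 * r)"
  note B = op_abs_positive[OF A] and C = op_abs_positive[OF A']
  have P: "positive_op ?P" and Q: "positive_op ?Q" and P2: "positive_op ?P2" and Q2: "positive_op ?Q2"
    using r by (auto intro!: op_powr_positive B C)
  note hP = positive_op_hermitian[OF P] and hQ = positive_op_hermitian[OF Q]
  note bP = positive_op_bounded_clinear[OF P] and bQ = positive_op_bounded_clinear[OF Q]
  have bsum: "bounded_clinear (\<lambda>x. ?P2 x + ?Q2 x)"
    by (intro bounded_clinear_add positive_op_bounded_clinear P2 Q2)
  have Re_eq: "op_Re (?P \<circ> ?Q) = (\<lambda>x. (1/2) *\<^sub>R (?P (?Q x) + ?Q (?P x)))"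
    by (rule op_Re_compose_hermitian[OF hP hQ])
  have bRe: "bounded_clinear (op_Re (?P \<circ> ?Q))"
    unfolding Re_eq
    by (intro bounded_clinear_compose[OF bounded_clinear_scaleR] bounded_clinear_add
        bounded_clinear_compose[OF bP bQ] bounded_clinear_compose[OF bQ bP])
  let ?s = "onorm (\<lambda>x. ?P2 x + ?Q2 x)"
  show "0 < 2 * r" using r by simp
  show "0 \<le> 1/4 * ?s + 1/2 * min (onorm (op_Re (?P \<circ> ?Q))) (numerical_radius (A \<circ> A) powr r)"
    using onorm_pos_le[OF bounded_clinear_bounded_linear[OF bsum]]
      onorm_pos_le[OF bounded_clinear_bounded_linear[OF bRe]] by simp
  fix x :: 'a assume x: "norm x = 1"
  let ?w = "cmod (cinner (A x) x)"
  have sum_le: "inner (?P2 x) x + inner (?Q2 x) x \<le> ?s"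
    using inner_le_onorm[OF bsum x] by (simp add: inner_add)
  have bound1: "?w powr (2 * r) \<le> 1/4 * ?s + 1/2 * onorm (op_Re (?P \<circ> ?Q))"
  proof -
    let ?b = "inner (op_abs A x) x" and ?c = "inner (op_abs (cadjoint A) x) x"
    have bc: "0 \<le> ?b" "0 \<le> ?c"
      using positive_op_inner[OF B] positive_op_inner[OF C] by simp_all
    have "?w powr (2 * r) = (?w\<^sup>2) powr r"
      by (simp add: powr_powr flip: powr_numeral)
    also have "\<dots> \<le> (?b * ?c) powr r"
    proof (rule powr_mono2)
      have "?w\<^sup>2 \<le> (sqrt ?b * sqrt ?c)\<^sup>2"
        by (intro power_mono mixed_Schwarz[OF A]) simp
      then show "?w\<^sup>2 \<le> ?b * ?c"
        using bc by (simp add: power_mult_distrib)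
    qed (use r in auto)
    also have "\<dots> = ?b powr r * ?c powr r"
      using bc by (simp add: powr_mult)
    also have "\<dots> \<le> inner (?P x) x * inner (?Q x) x"
      using inner_powr_le_op_powr[OF B r x] inner_powr_le_op_powr[OF C r x]
      by (intro mult_mono positive_op_inner[OF P]) auto
    \<comment> \<open>Merging the two factors before Cauchy-Schwarz leaves the real part of \<open>PQ\<close>, not \<open>PQ\<close> itself.\<close>
    also have "\<dots> \<le> (inner (?P x + ?Q x) x)\<^sup>2 / 4"
      using zero_le_power2[of "inner (?P x) x - inner (?Q x) x"]
      by (simp add: inner_add power2_eq_square algebra_simps)
    also have "\<dots> \<le> (norm (?P x + ?Q x))\<^sup>2 / 4"
      using Cauchy_Schwarz_ineq2[of "?P x + ?Q x" x] x
      by (simp flip: abs_le_square_iff)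
    also have "(norm (?P x + ?Q x))\<^sup>2
        = inner (?P2 x) x + inner (?Q2 x) x + 2 * inner (op_Re (?P \<circ> ?Q) x) x"
    proof -
      have "inner (?P2 x) x = inner (?P x) (?P x)" "inner (?Q2 x) x = inner (?Q x) (?Q x)"
        using r by (simp_all add: op_powr_op_powr[OF B, symmetric] op_powr_op_powr[OF C, symmetric]
            hermitian_op_inner[OF hP] hermitian_op_inner[OF hQ])
      moreover have "2 * inner (op_Re (?P \<circ> ?Q) x) x = inner (?P x) (?Q x) + inner (?Q x) (?P x)"
        by (simp add: Re_eq inner_add hermitian_op_inner[OF hP] hermitian_op_inner[OF hQ])
      ultimately show ?thesis
        unfolding power2_norm_eq_inner by (simp add: inner_add)
    qed
    finally show ?thesis
      using sum_le inner_le_onorm[OF bRe x] by simp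
  qed
  have bound2: "?w powr (2 * r) \<le> 1/4 * ?s + 1/2 * (numerical_radius (A \<circ> A) powr r)"
  proof -
    let ?a = "norm (A x)" and ?a' = "norm (cadjoint A x)" and ?v = "cmod (cinner (A (A x)) x)"
    have "?w\<^sup>2 = cmod (cinner (A x) x * cinner x (cadjoint A x))"
      by (simp add: power2_eq_square norm_mult flip: cinner_cadjoint[OF A])
    also have "\<dots> \<le> (?a * ?a' + cmod (cinner (A x) (cadjoint A x))) / 2"
      by (rule Buzano_inequality[OF x])
    also have "cinner (A x) (cadjoint A x) = cinner (A (A x)) x"
      by (simp flip: cinner_cadjoint[OF A])
    finally have "(?w\<^sup>2) powr r \<le> ((?a * ?a' + ?v) / 2) powr r"
      using r by (intro powr_mono2) auto
    also have "\<dots> \<le> ((?a * ?a') powr r + ?v powr r) / 2"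
      using r by (intro powr_Jensen_midpoint) auto
    also have "(?a * ?a') powr r \<le> (?a powr (2 * r) + ?a' powr (2 * r)) / 2"
    proof -
      have "0 \<le> (?a powr r - ?a' powr r)\<^sup>2" by simp
      then show ?thesis
        by (simp add: powr_mult power2_eq_square algebra_simps flip: powr_add)
    qed
    also have "?a powr (2 * r) + ?a' powr (2 * r) \<le> ?s"
      using norm_powr_le_op_powr_op_abs[OF A r x] norm_powr_le_op_powr_op_abs[OF A' r x] sum_le
      by simp
    also have "?v powr r \<le> numerical_radius (A \<circ> A) powr r"
      using cinner_le_numerical_radius[of "A \<circ> A" x] bounded_clinear_compose[OF A A] x r
      by (intro powr_mono2) (auto simp: o_def)
    finally show ?thesis
      by (simp add: powr_powr add_divide_distrib flip: powr_numeral)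
  qed
  show "?w powr (2 * r) \<le>
      1/4 * ?s + 1/2 * min (onorm (op_Re (?P \<circ> ?Q))) (numerical_radius (A \<circ> A) powr r)"
    using bound1 bound2 by (simp add: min_def)
qed

end
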